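(* Let $H$ be a separable complex Hilbert space, $A$ a strictly positive selfadjoint operator on $H$, and $f:\sigma(A)\to[0,\infty)$ a continuous function. Let $S(t)=e^{t\mathbb{A}}$ be the contraction semigroup on $\mathcal{H}=H^1\times H$ generated by the operator $\mathbb{A}(u,v)=(v,-Au-f(A)v)$ defined in the context. Assume that $S(t)$ is semiuniformly stable, and let $\psi(t)=\|S(t)\mathbb{A}^{-1}\|_{L(\mathcal{H})}$. If $A$ is unbounded and there exists $\beta>0$ such that $$\sup_{s\in\sigma(A)}s^{\beta}f(s)<\infty,$$ then $\psi(t)$ decays at most polynomially as $t^{-\frac1{2\beta}}$, namely, $$\limsup_{t\to\infty}t^{\frac{1}{2\beta}}\psi(t)>0 .$$
   Context: $(H,\langle\cdot,\cdot\rangle,\|\cdot\|)$ is a separable complex Hilbert space and $A:\mathrm{dom}(A)\subset H\to H$ is a strictly positive selfadjoint linear operator (so $\sigma(A)$ is a nonempty closed subset of $(0,\infty)$; $A^{-1}$ is not necessarily compact). $f:\sigma(A)\to[0,\infty)$ is continuous, and $f(A)=\int_{\sigma(A)}f(s)\,dE_A(s)$ is the selfadjoint operator given by the functional calculus, $E_A$ being the spectral measure of $A$. For $r>0$, $H^r=\mathrm{dom}(A^{r/2})$ with norm $\|u\|_r=\|A^{r/2}u\|$. The phase space is $\mathcal{H}=H^1\times H$ with norm $\|(u,v)\|_{\mathcal{H}}^2=\|u\|_1^2+\|v\|^2$. The operator $\mathbb{A}$ is $\mathbb{A}(u,v)=(v,\,-(Au+f(A)v))$ with domain $\mathrm{dom}(\mathbb{A})=\{(u,v)\in\mathcal{H}: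 v\in H^1,\ Au+f(A)v\in H\}$. Here, when $u\notin\mathrm{dom}(A)$ or $v\notin\mathrm{dom}(f(A))$, $Au$ and $f(A)v$ are understood by duality, as the functionals $w\mapsto\langle Aw,u\rangle$ on $\mathrm{dom}(A)$ and $w\mapsto\langle f(A)w,v\rangle$ on $\mathrm{dom}(f(A))$; thus $Au+f(A)v\in H$ means that there is $h\in H$ (then denoted $Au+f(A)v$) with $\langle Aw,u\rangle+\langle f(A)w,v\rangle=\langle w,h\rangle$ for all $w\in\mathrm{dom}(A)\cap\mathrm{dom}(f(A))$. The operator $\mathbb{A}$ generates a strongly continuous contraction semigroup $S(t)=e^{t\mathbb{A}}$ on $\mathcal{H}$. $S(t)$ is called semiuniformly stable if there exists a function $\psi_0:[0,\infty)\to[0,\infty)$ vanishing at infinity such that $\|S(t)z_0\|_{\mathcal{H}}\le\psi_0(t)\|\mathbb{A}z_0\|_{\mathcal{H}}$ for all $z_0\in\mathrm{dom}(\mathbb{A})$ and all $t\ge 0$; in that case $0\notin\sigma(\mathbb{A})$, so $\mathbb{A}^{-1}$ is a bounded operator on $\mathcal{H}$. $\|\cdot\|_{L(\mathcal{H})}$ is the operator norm. *)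

theory Defs
  imports "HOL-Analysis.Analysis"
begin

section \<open>Complex Hilbert spaces\<close>

text \<open>
  The inner product is linear in its first argument. Positivity and definiteness of
  \<open>cinner\<close> follow from \<open>norm_eq_sqrt_cinner\<close>, completeness from \<open>banach\<close>.
\<close>

class complex_hilbert = banach +
  fixes scaleC :: "complex \<Rightarrow> 'a \<Rightarrow> 'a" (infixr "*\<^sub>C" 75)
    and cinner :: "'a \<Rightarrow> 'a \<Rightarrow> complex"
  assumes scaleC_add_right: "a *\<^sub>C (x + y) = a *\<^sub>C x + a *\<^sub>C y"
    and scaleC_add_left: "(a + b) *\<^sub>C x = a *\<^sub>C x + b *\<^sub>C x"
    and scaleC_scaleC: "a *\<^sub>C (b *\<^sub>C x) = (a * b) *\<^sub>C x"
    and scaleR_scaleC: "r *\<^sub>R x = complex_of_real r *\<^sub>C x"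
    and cinner_commute: "cinner x y = cnj (cinner y x)"
    and cinner_add_left: "cinner (x + y) z = cinner x z + cinner y z"
    and cinner_scaleC_left: "cinner (a *\<^sub>C x) y = a * cinner x y"
    and norm_eq_sqrt_cinner: "norm x = sqrt (Re (cinner x x))"

instantiation complex :: complex_hilbert
begin

definition scaleC_complex :: "complex \<Rightarrow> complex \<Rightarrow> complex" where
  "scaleC_complex a x = a * x"

definition cinner_complex :: "complex \<Rightarrow> complex \<Rightarrow> complex" where
  "cinner_complex x y = x * cnj y"

instance
  by standard
    (auto simp: scaleC_complex_def cinner_complex_def algebra_simps scaleR_conv_of_real
      cmod_def power2_eq_square)

end

instantiation prod :: (complex_hilbert, complex_hilbert) complex_hilbert
begin

definition scaleC_prod :: "complex \<Rightarrow> 'a \<times> 'b \<Rightarrow> 'a \<times> 'b" where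
  "scaleC_prod a x = (a *\<^sub>C fst x, a *\<^sub>C snd x)"

definition cinner_prod :: "'a \<times> 'b \<Rightarrow> 'a \<times> 'b \<Rightarrow> complex" where
  "cinner_prod x y = cinner (fst x) (fst y) + cinner (snd x) (snd y)"

instance
proof
  fix x y z :: "'a \<times> 'b" and a b :: complex and r :: real
  show "a *\<^sub>C (x + y) = a *\<^sub>C x + a *\<^sub>C y"
    by (simp add: scaleC_prod_def scaleC_add_right)
  show "(a + b) *\<^sub>C x = a *\<^sub>C x + b *\<^sub>C x"
    by (simp add: scaleC_prod_def scaleC_add_left)
  show "a *\<^sub>C (b *\<^sub>C x) = (a * b) *\<^sub>C x"
    by (simp add: scaleC_prod_def scaleC_scaleC)
  show "r *\<^sub>R x = complex_of_real r *\<^sub>C x"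
    by (simp add: scaleC_prod_def scaleR_prod_def scaleR_scaleC)
  show "cinner x y = cnj (cinner y x)"
    using cinner_commute[of "fst x" "fst y"] cinner_commute[of "snd x" "snd y"]
    by (simp add: cinner_prod_def)
  show "cinner (x + y) z = cinner x z + cinner y z"
    by (simp add: cinner_prod_def cinner_add_left)
  show "cinner (a *\<^sub>C x) y = a * cinner x y"
    by (simp add: cinner_prod_def scaleC_prod_def cinner_scaleC_left distrib_left)
  have sq: "(norm u)\<^sup>2 = Re (cinner u u)" for u :: "'c::complex_hilbert"
    by (metis norm_eq_sqrt_cinner norm_ge_zero real_sqrt_ge_0_iff real_sqrt_pow2)
  show "norm x = sqrt (Re (cinner x x))"
    by (simp add: norm_prod_def cinner_prod_def sq)
qed

end


section \<open>Unbounded operators\<close>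

text \<open>
  An operator with domain in \<open>'a\<close> is a partial map; \<open>dom A\<close> is its domain and
  \<open>the (A x)\<close> its value at \<open>x \<in> dom A\<close>.
\<close>

definition csubspace :: "'a::complex_hilbert set \<Rightarrow> bool" where
  "csubspace M \<longleftrightarrow>
     0 \<in> M \<and> (\<forall>x\<in>M. \<forall>y\<in>M. x + y \<in> M) \<and> (\<forall>c. \<forall>x\<in>M. c *\<^sub>C x \<in> M)"

definition clinear_on :: "'a::complex_hilbert set \<Rightarrow> ('a \<Rightarrow> 'b::complex_hilbert) \<Rightarrow> bool" where
  "clinear_on M T \<longleftrightarrow>
     (\<forall>x\<in>M. \<forall>y\<in>M. T (x + y) = T x + T y) \<and> (\<forall>c. \<forall>x\<in>M. T (c *\<^sub>C x) = c *\<^sub>C T x)"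

definition linear_operator :: "('a::complex_hilbert \<rightharpoonup> 'b::complex_hilbert) \<Rightarrow> bool" where
  "linear_operator A \<longleftrightarrow> csubspace (dom A) \<and> clinear_on (dom A) (\<lambda>x. the (A x))"

definition op_adjoint :: "('a::complex_hilbert \<rightharpoonup> 'a) \<Rightarrow> ('a \<rightharpoonup> 'a)" where
  "op_adjoint A y =
     (if \<exists>z. \<forall>x\<in>dom A. cinner (the (A x)) y = cinner x z
      then Some (THE z. \<forall>x\<in>dom A. cinner (the (A x)) y = cinner x z) else None)"

definition selfadjoint :: "('a::complex_hilbert \<rightharpoonup> 'a) \<Rightarrow> bool" where
  "selfadjoint A \<longleftrightarrow> linear_operator A \<and> closure (dom A) = UNIV \<and> op_adjoint A = A"

definition strictly_positive :: "('a::complex_hilbert \<rightharpoonup> 'a) \<Rightarrow> bool" where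
  "strictly_positive A \<longleftrightarrow> (\<exists>c>0. \<forall>x\<in>dom A. c * (norm x)\<^sup>2 \<le> Re (cinner (the (A x)) x))"

definition unbounded_operator :: "('a::complex_hilbert \<rightharpoonup> 'b::complex_hilbert) \<Rightarrow> bool" where
  "unbounded_operator A \<longleftrightarrow> \<not> (\<exists>K. \<forall>x\<in>dom A. norm (the (A x)) \<le> K * norm x)"

definition resolvent_set :: "('a::complex_hilbert \<rightharpoonup> 'a) \<Rightarrow> complex set" where
  "resolvent_set A =
     {l. bij_betw (\<lambda>x. the (A x) - l *\<^sub>C x) (dom A) UNIV \<and>
         (\<exists>K. \<forall>x\<in>dom A. norm x \<le> K * norm (the (A x) - l *\<^sub>C x))}"

definition spectrum :: "('a::complex_hilbert \<rightharpoonup> 'a) \<Rightarrow> complex set" where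
  "spectrum A = - resolvent_set A"

text \<open>
  For selfadjoint \<open>A\<close> the spectrum is real, so this is the whole spectrum, regarded as a
  subset of the real line.
\<close>

definition real_spectrum :: "('a::complex_hilbert \<rightharpoonup> 'a) \<Rightarrow> real set" where
  "real_spectrum A = {s. complex_of_real s \<in> spectrum A}"

definition op_inverse :: "('a \<rightharpoonup> 'b) \<Rightarrow> ('b \<rightharpoonup> 'a)" where
  "op_inverse A y = (if \<exists>!x. A x = Some y then Some (THE x. A x = Some y) else None)"


section \<open>Spectral measures and functional calculus\<close>

definition orthogonal_projection :: "('a::complex_hilbert \<Rightarrow> 'a) \<Rightarrow> bool" where
  "orthogonal_projection P \<longleftrightarrow>
     clinear_on UNIV P \<and> (\<forall>x. P (P x) = P x) \<and> (\<forall>x y. cinner (P x) y = cinner x (P y))"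

definition projection_valued_measure :: "(real set \<Rightarrow> 'a::complex_hilbert \<Rightarrow> 'a) \<Rightarrow> bool" where
  "projection_valued_measure E \<longleftrightarrow>
     (\<forall>B\<in>sets borel. orthogonal_projection (E B)) \<and>
     (\<forall>x. E UNIV x = x) \<and>
     (\<forall>B :: nat \<Rightarrow> real set. range B \<subseteq> sets borel \<longrightarrow> disjoint_family B \<longrightarrow>
        (\<forall>x. (\<lambda>n. E (B n) x) sums E (\<Union>n. B n) x))"

definition scalar_measure :: "(real set \<Rightarrow> 'a::complex_hilbert \<Rightarrow> 'a) \<Rightarrow> 'a \<Rightarrow> real measure" where
  "scalar_measure E x = measure_of UNIV (sets borel) (\<lambda>B. ennreal (Re (cinner (E B x) x)))"

definition simple_spectral_integral ::
    "(real set \<Rightarrow> 'a::complex_hilbert \<Rightarrow> 'a) \<Rightarrow> (real \<Rightarrow> real) \<Rightarrow> 'a \<Rightarrow> 'a" where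
  "simple_spectral_integral E g x = (\<Sum>c\<in>range g. c *\<^sub>R E (g -` {c}) x)"

text \<open>
  The map \<open>g \<mapsto> simple_spectral_integral E g x\<close> is an \<open>L\<^sup>2 (scalar_measure E x)\<close>-isometry on
  simple functions; the operator \<open>\<integral> g dE\<close> at \<open>x\<close> is the value at \<open>g\<close> of its extension by
  density, and its domain is the set of all \<open>x\<close> with \<open>g\<close> in \<open>L\<^sup>2 (scalar_measure E x)\<close>.
\<close>

definition spectral_integral ::
    "(real set \<Rightarrow> 'a::complex_hilbert \<Rightarrow> 'a) \<Rightarrow> (real \<Rightarrow> real) \<Rightarrow> ('a \<rightharpoonup> 'a)" where
  "spectral_integral E g x =
     (if integrable (scalar_measure E x) (\<lambda>s. (g s)\<^sup>2)
      then Some (THE y. \<exists>\<sigma> :: nat \<Rightarrow> real \<Rightarrow> real.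
             (\<forall>n. simple_function borel (\<sigma> n)) \<and>
             (\<lambda>n. \<integral>s. (\<sigma> n s - g s)\<^sup>2 \<partial>scalar_measure E x) \<longlonglongrightarrow> 0 \<and>
             (\<lambda>n. simple_spectral_integral E (\<sigma> n) x) \<longlonglongrightarrow> y)
      else None)"

definition is_spectral_measure ::
    "('a::complex_hilbert \<rightharpoonup> 'a) \<Rightarrow> (real set \<Rightarrow> 'a \<Rightarrow> 'a) \<Rightarrow> bool" where
  "is_spectral_measure A E \<longleftrightarrow>
     projection_valued_measure E \<and> A = spectral_integral E (\<lambda>s. s)"

text \<open>
  \<open>g(A) = \<integral> g dE\<close> over \<open>\<sigma>(A)\<close>, where \<open>E\<close> is the spectral measure of \<open>A\<close>; only the values
  of \<open>g\<close> on the spectrum matter.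
\<close>

definition functional_calculus ::
    "('a::complex_hilbert \<rightharpoonup> 'a) \<Rightarrow> (real set \<Rightarrow> 'a \<Rightarrow> 'a) \<Rightarrow> (real \<Rightarrow> real) \<Rightarrow> ('a \<rightharpoonup> 'a)" where
  "functional_calculus A E g =
     spectral_integral E (\<lambda>s. if s \<in> real_spectrum A then g s else 0)"

definition op_powr ::
    "('a::complex_hilbert \<rightharpoonup> 'a) \<Rightarrow> (real set \<Rightarrow> 'a \<Rightarrow> 'a) \<Rightarrow> real \<Rightarrow> ('a \<rightharpoonup> 'a)" where
  "op_powr A E a = functional_calculus A E (\<lambda>s. s powr a)"


section \<open>The damped wave operator on the phase space\<close>

definition H_space ::
    "('a::complex_hilbert \<rightharpoonup> 'a) \<Rightarrow> (real set \<Rightarrow> 'a \<Rightarrow> 'a) \<Rightarrow> real \<Rightarrow> 'a set" where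
  "H_space A E r = dom (op_powr A E (r / 2))"

definition H_norm ::
    "('a::complex_hilbert \<rightharpoonup> 'a) \<Rightarrow> (real set \<Rightarrow> 'a \<Rightarrow> 'a) \<Rightarrow> real \<Rightarrow> 'a \<Rightarrow> real" where
  "H_norm A E r u = norm (the (op_powr A E (r / 2) u))"

definition phase_space ::
    "('a::complex_hilbert \<rightharpoonup> 'a) \<Rightarrow> (real set \<Rightarrow> 'a \<Rightarrow> 'a) \<Rightarrow> ('a \<times> 'a) set" where
  "phase_space A E = H_space A E 1 \<times> UNIV"

definition phase_norm ::
    "('a::complex_hilbert \<rightharpoonup> 'a) \<Rightarrow> (real set \<Rightarrow> 'a \<Rightarrow> 'a) \<Rightarrow> 'a \<times> 'a \<Rightarrow> real" where
  "phase_norm A E z = sqrt ((H_norm A E 1 (fst z))\<^sup>2 + (norm (snd z))\<^sup>2)"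

text \<open>
  \<open>represents_sum A B u v h\<close> says that \<open>A u + B v = h\<close> holds in the sense of duality.
\<close>

definition represents_sum ::
    "('a::complex_hilbert \<rightharpoonup> 'a) \<Rightarrow> ('a \<rightharpoonup> 'a) \<Rightarrow> 'a \<Rightarrow> 'a \<Rightarrow> 'a \<Rightarrow> bool" where
  "represents_sum A B u v h \<longleftrightarrow>
     (\<forall>w \<in> dom A \<inter> dom B. cinner (the (A w)) u + cinner (the (B w)) v = cinner w h)"

definition damped_operator ::
    "('a::complex_hilbert \<rightharpoonup> 'a) \<Rightarrow> (real set \<Rightarrow> 'a \<Rightarrow> 'a) \<Rightarrow> (real \<Rightarrow> real) \<Rightarrow> ('a \<times> 'a \<rightharpoonup> 'a \<times> 'a)"
  where
  "damped_operator A E f = (\<lambda>(u, v).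
     if (u, v) \<in> phase_space A E \<and> v \<in> H_space A E 1 \<and>
        (\<exists>h. represents_sum A (functional_calculus A E f) u v h)
     then Some (v, - (THE h. represents_sum A (functional_calculus A E f) u v h))
     else None)"


section \<open>Contraction semigroups\<close>

text \<open>
  The phase space does not carry the norm of the type \<open>'a \<times> 'a\<close>, so the space \<open>X\<close> and its
  norm \<open>N\<close> are explicit. Only the restrictions to \<open>X\<close> of the maps \<open>S t\<close> with \<open>t \<ge> 0\<close> matter.
\<close>

definition contraction_semigroup ::
    "'a::complex_hilbert set \<Rightarrow> ('a \<Rightarrow> real) \<Rightarrow> (real \<Rightarrow> 'a \<Rightarrow> 'a) \<Rightarrow> bool" where
  "contraction_semigroup X N S \<longleftrightarrow>
     (\<forall>t\<ge>0. S t ` X \<subseteq> X \<and> clinear_on X (S t) \<and> (\<forall>z\<in>X. N (S t z) \<le> N z)) \<and>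
     (\<forall>z\<in>X. S 0 z = z) \<and>
     (\<forall>s\<ge>0. \<forall>t\<ge>0. \<forall>z\<in>X. S (s + t) z = S s (S t z)) \<and>
     (\<forall>z\<in>X. ((\<lambda>t. N (S t z - z)) \<longlongrightarrow> 0) (at_right 0))"

definition has_generator_value ::
    "'a::complex_hilbert set \<Rightarrow> ('a \<Rightarrow> real) \<Rightarrow> (real \<Rightarrow> 'a \<Rightarrow> 'a) \<Rightarrow> 'a \<Rightarrow> 'a \<Rightarrow> bool" where
  "has_generator_value X N S z y \<longleftrightarrow>
     z \<in> X \<and> y \<in> X \<and> ((\<lambda>t. N ((1 / t) *\<^sub>R (S t z - z) - y)) \<longlongrightarrow> 0) (at_right 0)"

definition generator ::
    "'a::complex_hilbert set \<Rightarrow> ('a \<Rightarrow> real) \<Rightarrow> (real \<Rightarrow> 'a \<Rightarrow> 'a) \<Rightarrow> ('a \<rightharpoonup> 'a)" where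
  "generator X N S z =
     (if \<exists>y. has_generator_value X N S z y
      then Some (THE y. has_generator_value X N S z y) else None)"

definition semiuniformly_stable ::
    "('a::complex_hilbert \<Rightarrow> real) \<Rightarrow> ('a \<rightharpoonup> 'a) \<Rightarrow> (real \<Rightarrow> 'a \<Rightarrow> 'a) \<Rightarrow> bool" where
  "semiuniformly_stable N G S \<longleftrightarrow>
     (\<exists>\<psi>\<^sub>0 :: real \<Rightarrow> real. (\<forall>t\<ge>0. 0 \<le> \<psi>\<^sub>0 t) \<and> (\<psi>\<^sub>0 \<longlongrightarrow> 0) at_top \<and>
        (\<forall>z\<in>dom G. \<forall>t\<ge>0. N (S t z) \<le> \<psi>\<^sub>0 t * N (the (G z))))"

definition operator_norm :: "'a set \<Rightarrow> ('a \<Rightarrow> real) \<Rightarrow> ('a \<Rightarrow> 'a) \<Rightarrow> real" where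
  "operator_norm X N T = (SUP z \<in> {z \<in> X. N z \<le> 1}. N (T z))"

definition decay_rate ::
    "'a set \<Rightarrow> ('a \<Rightarrow> real) \<Rightarrow> ('a \<rightharpoonup> 'a) \<Rightarrow> (real \<Rightarrow> 'a \<Rightarrow> 'a) \<Rightarrow> real \<Rightarrow> real" where
  "decay_rate X N G S t = operator_norm X N (\<lambda>z. S t (the (op_inverse G z)))"

end

theory Submission
  imports Defs
begin

text \<open>
  Since \<open>A\<close> is unbounded, its spectral measure charges every neighbourhood of arbitrarily large
  points \<open>s\<^sub>0\<close>. A vector \<open>x\<close> in the spectral subspace of a small ball around \<open>s\<^sub>0\<close> yields a
  quasi-eigenvector \<open>z = (x, \<i> \<surd>s\<^sub>0 x)\<close> of the damped wave operator for the value \<open>\<i> \<surd>s\<^sub>0\<close>. As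
  \<open>f = O(s\<^sub>0 powr -\<beta>)\<close> there, the relative error is \<open>O(s\<^sub>0 powr -\<beta>)\<close>, so the orbit of \<open>z\<close> keeps half
  of its norm up to a time \<open>t\<close> of order \<open>s\<^sub>0 powr \<beta>\<close>. The operator multiplies the norm of \<open>z\<close> by
  about \<open>\<surd>s\<^sub>0\<close>, hence the decay rate at \<open>t\<close> is at least a constant times
  \<open>1 / \<surd>s\<^sub>0\<close>, that is, \<open>t powr (-1 / (2 * \<beta>))\<close>.
\<close>

section \<open>Complex inner product spaces\<close>

text \<open>The pair \<open>(x, l x)\<close> with l = \<i> sqrt s0 misses the eigenvalue equation
  only in its second component, by \<open>(A - s0) x + l f(A) x\<close> up to sign. Its norm is
  comparable to sqrt s0 * norm x, so a ball of radius at most s0 powr (1/2 - \<beta>) keeps the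
  first term of the order of the bound for the second. The exponent 1 / (2 * \<beta>) compares two
  powers of s0: the lifetime s0 powr \<beta> of the orbit and the factor sqrt s0 gained by applying
  the operator. One obstacle is that \<open>E\<close> is known only through A = \<integral> s dE.
  Since \<open>functional_calculus\<close> cuts functions off outside the spectrum, \<open>E\<close>
  must be proved null there and on the nonpositive reals; otherwise the square root of A could have
  a kernel and the phase norm would not be definite. The other is that the sum Au + f(A)v, the
  generator, the inverse and the integral itself are definite descriptions: each needs a uniqueness
  proof (density of truncated vectors, definiteness of the norm, injectivity, independence of the
  approximation) before its value can be used.\<close>

lemma norm_sq_cinner: "(norm (x::'a::complex_hilbert))\<^sup>2 = Re (cinner x x)"
  by (metis norm_eq_sqrt_cinner norm_ge_zero real_sqrt_ge_0_iff real_sqrt_pow2)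

lemma cinner_self: "cinner x x = of_real ((norm (x::'a::complex_hilbert))\<^sup>2)"
proof -
  have "Im (cinner x x) = 0"
    using cinner_commute[of x x] by (metis Reals_cnj_iff complex_is_Real_iff)
  then show ?thesis by (simp add: complex_eq_iff norm_sq_cinner)
qed

lemma cinner_scaleR_left: "cinner (r *\<^sub>R x) y = of_real r * cinner x y"
  by (simp add: scaleR_scaleC cinner_scaleC_left)

lemma cinner_add_right: "cinner x (y + z) = cinner x y + cinner x z"
  by (metis cinner_add_left cinner_commute complex_cnj_add)

lemma cinner_scaleC_right: "cinner x (a *\<^sub>C y) = cnj a * cinner x y"
  by (metis cinner_scaleC_left cinner_commute complex_cnj_mult)

lemma cinner_scaleR_right: "cinner x (r *\<^sub>R y) = of_real r * cinner x y"
  by (simp add: scaleR_scaleC cinner_scaleC_right)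

lemma cinner_minus_left: "cinner (- x) y = - cinner x y"
  using cinner_scaleR_left[of "-1" x y] by simp

lemma cinner_minus_right: "cinner x (- y) = - cinner x y"
  using cinner_scaleR_right[of x "-1" y] by simp

lemma cinner_diff_left: "cinner (x - z) y = cinner x y - cinner z y"
  by (metis cinner_add_left cinner_minus_left diff_conv_add_uminus)

lemma cinner_diff_right: "cinner x (y - z) = cinner x y - cinner x z"
  by (metis cinner_add_right cinner_minus_right diff_conv_add_uminus)

lemma norm_scaleC: "norm (a *\<^sub>C x) = cmod a * norm (x::'a::complex_hilbert)"
proof -
  have "(norm (a *\<^sub>C x))\<^sup>2 = Re (a * cnj a * cinner x x)"
    by (simp only: norm_sq_cinner cinner_scaleC_left cinner_scaleC_right mult_ac)
  also have "\<dots> = (cmod a * norm x)\<^sup>2"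
    by (simp add: cinner_self complex_norm_square[symmetric] power_mult_distrib
        flip: of_real_mult of_real_power)
  finally show ?thesis
    by (metis norm_ge_zero mult_nonneg_nonneg power2_eq_imp_eq)
qed

lemma scaleC_scaleR: "a *\<^sub>C (r *\<^sub>R x) = r *\<^sub>R (a *\<^sub>C (x::'a::complex_hilbert))"
  by (simp add: scaleR_scaleC scaleC_scaleC mult.commute)

lemma linear_scaleC: "linear (\<lambda>x. a *\<^sub>C (x::'a::complex_hilbert))"
  by (rule linearI) (simp_all add: scaleC_add_right scaleC_scaleR)

lemma scaleC_minus_right: "a *\<^sub>C (- x) = - (a *\<^sub>C (x::'a::complex_hilbert))"
  using linear_scaleC by (rule linear_neg)

lemma scaleC_diff_right: "a *\<^sub>C (x - y) = a *\<^sub>C x - a *\<^sub>C (y::'a::complex_hilbert)"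
  using linear_scaleC by (rule linear_diff)

lemma scaleC_minus_left: "(- a) *\<^sub>C x = - (a *\<^sub>C (x::'a::complex_hilbert))"
proof -
  have "(- a) *\<^sub>C x = a *\<^sub>C ((-1) *\<^sub>R x)"
    by (simp add: scaleR_scaleC scaleC_scaleC del: scaleR_minus1_left)
  then show ?thesis by (simp add: scaleC_minus_right)
qed

lemma scaleC_diff_left: "(a - b) *\<^sub>C x = a *\<^sub>C x - b *\<^sub>C (x::'a::complex_hilbert)"
  by (metis diff_conv_add_uminus scaleC_add_left scaleC_minus_left)

lemma scaleC_zero_right [simp]: "a *\<^sub>C 0 = (0::'a::complex_hilbert)"
  using linear_scaleC by (rule linear_0)

lemma scaleC_zero_left [simp]: "0 *\<^sub>C x = (0::'a::complex_hilbert)"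
  by (metis scaleR_scaleC of_real_0 scaleR_zero_left)

lemma scaleC_one [simp]: "1 *\<^sub>C x = (x::'a::complex_hilbert)"
  by (metis scaleR_scaleC of_real_1 scaleR_one)

lemma cinner_zero_left [simp]: "cinner 0 (y::'a::complex_hilbert) = 0"
  using cinner_scaleR_left[of 0 0 y] by simp

lemma cinner_zero_right [simp]: "cinner (y::'a::complex_hilbert) 0 = 0"
  using cinner_scaleR_right[of y 0 0] by simp

lemma norm_add_sq:
  "(norm (x + y))\<^sup>2 = (norm x)\<^sup>2 + 2 * Re (cinner x y) + (norm (y::'a::complex_hilbert))\<^sup>2"
proof -
  have "Re (cinner y x) = Re (cinner x y)" using cinner_commute[of y x] by simp
  then show ?thesis by (simp add: norm_sq_cinner cinner_add_left cinner_add_right)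
qed

text \<open>The class already provides the triangle inequality for the norm; squaring and expanding
  it leaves exactly this cross term.\<close>

lemma Re_cinner_le: "Re (cinner x y) \<le> norm x * norm (y::'a::complex_hilbert)"
proof -
  have "(norm (x + y))\<^sup>2 \<le> (norm x + norm y)\<^sup>2"
    by (simp add: norm_triangle_ineq)
  then show ?thesis by (simp add: norm_add_sq power2_sum)
qed

text \<open>A unimodular factor \<open>c\<close> rotates the inner product onto the positive real
  axis, where the bound for the real part applies.\<close>

lemma cmod_cinner_le: "cmod (cinner x y) \<le> norm x * norm (y::'a::complex_hilbert)"
proof (cases "cinner x y = 0")
  case False
  define c where "c = cnj (sgn (cinner x y))"
  have c: "cmod c = 1" using False by (simp add: c_def norm_sgn)
  have "c * cinner x y = of_real (cmod (cinner x y))"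
    using False by (simp add: c_def sgn_eq complex_norm_square[symmetric] mult.commute[of "cnj _"]
        power2_eq_square)
  then have "Re (cinner (c *\<^sub>C x) y) = cmod (cinner x y)" by (simp add: cinner_scaleC_left)
  then show ?thesis using Re_cinner_le[of "c *\<^sub>C x" y] c by (simp add: norm_scaleC)
qed simp

lemma bounded_bilinear_cinner: "bounded_bilinear (cinner :: 'a::complex_hilbert \<Rightarrow> 'a \<Rightarrow> complex)"
  by standard
    (auto simp: cinner_add_left cinner_add_right cinner_scaleR_left cinner_scaleR_right
      scaleR_conv_of_real intro!: exI[of _ 1] cmod_cinner_le)

lemmas tendsto_cinner = bounded_bilinear.tendsto[OF bounded_bilinear_cinner]

lemma bounded_linear_scaleC: "bounded_linear (\<lambda>x. a *\<^sub>C (x::'a::complex_hilbert))"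
  by (rule bounded_linear_intro[of _ "cmod a"])
    (simp_all add: scaleC_add_right scaleC_scaleR norm_scaleC mult.commute)

lemma cinner_sum_left: "cinner (sum g I) y = (\<Sum>i\<in>I. cinner (g i) y)"
  by (induction I rule: infinite_finite_induct) (auto simp: cinner_add_left)

lemma cinner_sum_right: "cinner y (sum g I) = (\<Sum>i\<in>I. cinner y (g i))"
  by (induction I rule: infinite_finite_induct) (auto simp: cinner_add_right)

lemma cinner_eq_0_dense:
  fixes d :: "'a::complex_hilbert"
  assumes "\<And>w. w \<in> D \<Longrightarrow> cinner w d = 0" "closure D = UNIV"
  shows "d = 0"
proof -
  obtain w where w: "\<And>n. w n \<in> D" "w \<longlonglongrightarrow> d"
    using assms(2) by (metis UNIV_I closure_sequential)
  have "(\<lambda>n. cinner (w n) d) \<longlonglongrightarrow> cinner d d"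
    by (intro tendsto_cinner w tendsto_const)
  then have "cinner d d = 0"
    using assms(1) w(1) by (simp add: LIMSEQ_const_iff)
  then show ?thesis by (simp add: cinner_self)
qed

section \<open>Projection-valued measures\<close>

locale pvm =
  fixes E :: "real set \<Rightarrow> 'h::complex_hilbert \<Rightarrow> 'h"
  assumes pvm: "projection_valued_measure E"
begin

lemma E_proj: "B \<in> sets borel \<Longrightarrow> orthogonal_projection (E B)"
  using pvm by (simp add: projection_valued_measure_def)

lemma E_UNIV [simp]: "E UNIV x = x"
  using pvm by (simp add: projection_valued_measure_def)

lemma E_add: "B \<in> sets borel \<Longrightarrow> E B (x + y) = E B x + E B y"
  using E_proj by (simp add: orthogonal_projection_def clinear_on_def)

lemma E_scaleC: "B \<in> sets borel \<Longrightarrow> E B (c *\<^sub>C x) = c *\<^sub>C E B x"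
  using E_proj by (simp add: orthogonal_projection_def clinear_on_def)

lemma E_idem: "B \<in> sets borel \<Longrightarrow> E B (E B x) = E B x"
  using E_proj by (simp add: orthogonal_projection_def)

lemma E_sym: "B \<in> sets borel \<Longrightarrow> cinner (E B x) y = cinner x (E B y)"
  using E_proj by (simp add: orthogonal_projection_def)

lemma norm_E_sq: "B \<in> sets borel \<Longrightarrow> Re (cinner (E B x) x) = (norm (E B x))\<^sup>2"
  by (metis E_idem E_sym norm_sq_cinner)

lemma norm_E_le: assumes B: "B \<in> sets borel" shows "norm (E B x) \<le> norm x"
proof (cases "E B x = 0")
  case False
  have "(norm (E B x))\<^sup>2 \<le> norm (E B x) * norm x"
    using Re_cinner_le[of "E B x" x] by (simp add: norm_E_sq B)
  then show ?thesis using False by (simp add: power2_eq_square)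
qed simp

lemma linear_E: "B \<in> sets borel \<Longrightarrow> linear (E B)"
  by (rule linearI) (simp_all add: E_add E_scaleC scaleR_scaleC)

lemma bounded_linear_E: "B \<in> sets borel \<Longrightarrow> bounded_linear (E B)"
  by (rule bounded_linear_intro[of _ 1])
    (simp_all add: E_add E_scaleC scaleR_scaleC norm_E_le)

lemma E_sums:
  "range B \<subseteq> sets borel \<Longrightarrow> disjoint_family B \<Longrightarrow> (\<lambda>n::nat. E (B n) x) sums E (\<Union>n. B n) x"
  using pvm by (simp add: projection_valued_measure_def)

text \<open>A countable union of empty sets makes a constant series converge, so its terms tend to
  0.\<close>

lemma E_empty [simp]: "E {} x = 0"
proof -
  have "(\<lambda>n::nat. E {} x) sums E (\<Union>n::nat. {}) x"
    by (rule E_sums) (auto simp: disjoint_family_on_def)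
  then have "(\<lambda>n::nat. E {} x) \<longlonglongrightarrow> 0"
    by (intro summable_LIMSEQ_zero) (auto simp: sums_iff)
  then show ?thesis by (simp add: LIMSEQ_const_iff)
qed

lemma E_Un:
  assumes "B \<in> sets borel" "C \<in> sets borel" "B \<inter> C = {}"
  shows "E (B \<union> C) x = E B x + E C x"
proof -
  have "(\<lambda>n. E (binaryset B C n) x) sums E (\<Union>n. binaryset B C n) x"
    using assms by (intro E_sums) (auto simp: range_binaryset_eq disjoint_family_on_def binaryset_def)
  then have 1: "(\<lambda>n. E (binaryset B C n) x) sums E (B \<union> C) x"
    by (simp add: UN_binaryset_eq)
  have "(\<lambda>n. E (binaryset B C n) x) sums (\<Sum>n\<in>{0,1}. E (binaryset B C n) x)"
    by (rule sums_finite) (auto simp: binaryset_def)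
  then have "(\<lambda>n. E (binaryset B C n) x) sums (E B x + E C x)"
    by (simp add: binaryset_def)
  with 1 show ?thesis by (rule sums_unique2)
qed

text \<open>If the sum of the projections \<open>P = E B\<close>, \<open>Q = E C\<close> is a projection, then \<open>PQ + QP = 0\<close>;
  multiplying by \<open>P\<close> from both sides gives \<open>PQ = QP\<close>, whence \<open>PQ = 0\<close>.\<close>

lemma E_disjoint:
  assumes B: "B \<in> sets borel" and C: "C \<in> sets borel" and BC: "B \<inter> C = {}"
  shows "E B (E C x) = 0"
proof -
  have anti: "E B (E C y) + E C (E B y) = 0" for y
  proof -
    have "E (B \<union> C) (E (B \<union> C) y) = E (B \<union> C) y" using B C by (intro E_idem) auto
    then show ?thesis using assms by (simp add: E_Un E_add E_idem add.commute)
  qed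
  have "E B (E C x) + E B (E C (E B x)) = 0"
    using arg_cong[OF anti[of x], of "E B"] B by (simp add: E_add E_idem linear_0[OF linear_E])
  moreover have "E B (E C (E B x)) + E C (E B x) = 0"
    using anti[of "E B x"] B by (simp add: E_idem)
  ultimately have "E B (E C x) = E C (E B x)"
    by (metis add.commute add_left_cancel)
  then have "2 *\<^sub>R E B (E C x) = 0" using anti[of x] by (simp add: scaleR_2)
  then show ?thesis by simp
qed

text \<open>Both sets are split along their intersection; the cross terms vanish by
  \<open>E_disjoint\<close>.\<close>

lemma E_Int:
  assumes B: "B \<in> sets borel" and C: "C \<in> sets borel"
  shows "E B (E C x) = E (B \<inter> C) x"
proof -
  have "E C x = E (B \<inter> C) x + E (C - B) x"
    using B C by (subst E_Un[symmetric]) (auto intro!: arg_cong2[of _ _ _ _ E])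
  moreover have "E B y = E (B \<inter> C) y + E (B - C) y" for y
    using B C by (subst E_Un[symmetric]) (auto intro!: arg_cong2[of _ _ _ _ E])
  moreover have "E (B - C) (E (B \<inter> C) x) = 0"
    by (rule E_disjoint) (use B C in auto)
  moreover have "E B (E (C - B) x) = 0"
    by (rule E_disjoint) (use B C in auto)
  ultimately show ?thesis using B C by (simp add: E_add E_idem)
qed

lemma E_UN_finite:
  assumes "finite I" "\<And>i. i \<in> I \<Longrightarrow> B i \<in> sets borel" "disjoint_family_on B I"
  shows "E (\<Union>i\<in>I. B i) x = (\<Sum>i\<in>I. E (B i) x)"
  using assms
proof (induction I rule: finite_induct)
  case (insert i I)
  have "E (B i \<union> (\<Union>i\<in>I. B i)) x = E (B i) x + E (\<Union>i\<in>I. B i) x"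
    using insert by (intro E_Un) (auto simp: disjoint_family_on_def)
  then show ?case using insert by (simp add: disjoint_family_on_def)
qed simp

section \<open>Scalar measures attached to vectors\<close>

abbreviation M where "M \<equiv> scalar_measure E"

lemma space_M [simp]: "space (M x) = UNIV"
  by (simp add: scalar_measure_def space_measure_of_conv)

lemma sets_M [simp, measurable_cong]: "sets (M x) = sets borel"
proof -
  have "sigma_algebra UNIV (sets borel :: real set set)"
    using sets.sigma_algebra_axioms[of "borel :: real measure"] by simp
  then show ?thesis by (simp add: scalar_measure_def sigma_algebra.sigma_sets_eq sets_measure_of_conv)
qed

text \<open>\<open>measure_of\<close> returns the prescribed values only once they are known to form
  a measure. Countable additivity is that of \<open>E\<close>, pushed through the continuous
  functional \<open>w \<mapsto> Re (cinner w x)\<close>.\<close>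

lemma emeasure_M: assumes B: "B \<in> sets borel" shows "emeasure (M x) B = ennreal ((norm (E B x))\<^sup>2)"
proof -
  let ?\<mu> = "\<lambda>B. ennreal (Re (cinner (E B x) x))"
  have "sigma_algebra UNIV (sets borel :: real set set)"
    using sets.sigma_algebra_axioms[of "borel :: real measure"] by simp
  then interpret sigma_algebra UNIV "sets borel :: real set set" .
  have "emeasure (M x) B = ?\<mu> B"
    unfolding scalar_measure_def
  proof (rule emeasure_measure_of_sigma)
    show "sigma_algebra UNIV (sets borel :: real set set)" by fact
    show "positive (sets borel) ?\<mu>" by (simp add: positive_def)
    show "countably_additive (sets borel) ?\<mu>"
    proof (rule countably_additiveI)
      fix C :: "nat \<Rightarrow> real set"
      assume C: "range C \<subseteq> sets borel" "disjoint_family C"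
      have "(\<lambda>n. Re (cinner (E (C n) x) x)) sums Re (cinner (E (\<Union>n. C n) x) x)"
        by (intro bounded_linear.sums[OF bounded_linear_Re]
            bounded_linear.sums[OF bounded_bilinear.bounded_linear_left[OF bounded_bilinear_cinner]]
            E_sums C)
      moreover have "0 \<le> Re (cinner (E (C n) x) x)" for n
        using C by (subst norm_E_sq) auto
      ultimately show "(\<Sum>n. ?\<mu> (C n)) = ?\<mu> (\<Union>n. C n)"
        by (intro suminf_ennreal_eq)
    qed
    show "B \<in> sets borel" by fact
  qed
  then show ?thesis using B by (simp add: norm_E_sq)
qed

sublocale finite_measure "M x" for x
  by standard (simp add: emeasure_M)

lemma measure_M: "B \<in> sets borel \<Longrightarrow> measure (M x) B = (norm (E B x))\<^sup>2"
  by (simp add: measure_def emeasure_M)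

section \<open>Spectral integrals\<close>

abbreviation simple_int where "simple_int \<equiv> simple_spectral_integral E"

lemma simple_borelD:
  assumes "simple_function borel (p :: real \<Rightarrow> 'b)"
  shows "finite (range p)" "p -` {k} \<in> sets borel"
  using simple_functionD[OF assms] by auto

text \<open>Meant for a pair p = (\<sigma>, \<tau>) of simple functions: its fibres refine the level
  sets of both, so \<sigma>, \<tau> and \<sigma> - \<tau> are all integrated over one common
  partition.\<close>

lemma simple_int_partition:
  fixes p :: "real \<Rightarrow> 'b"
  assumes p: "simple_function borel p"
  shows "simple_int (\<lambda>s. \<phi> (p s)) x = (\<Sum>k\<in>range p. \<phi> k *\<^sub>R E (p -` {k}) x)"
proof -
  have fin: "finite (range p)" by (rule simple_borelD[OF p])
  have E_eq: "E ((\<lambda>s. \<phi> (p s)) -` {c}) x = (\<Sum>k\<in>{k\<in>range p. \<phi> k = c}. E (p -` {k}) x)" for c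
  proof -
    have "(\<lambda>s. \<phi> (p s)) -` {c} = (\<Union>k\<in>{k\<in>range p. \<phi> k = c}. p -` {k})" by auto
    then show ?thesis
      using fin simple_borelD(2)[OF p]
      by (simp only:) (intro E_UN_finite, auto simp: disjoint_family_on_def)
  qed
  have "(\<Sum>k\<in>range p. \<phi> k *\<^sub>R E (p -` {k}) x)
      = (\<Sum>c\<in>\<phi> ` range p. \<Sum>k\<in>{k\<in>range p. \<phi> k = c}. \<phi> k *\<^sub>R E (p -` {k}) x)"
    using fin by (rule sum.image_gen)
  also have "\<dots> = (\<Sum>c\<in>\<phi> ` range p. c *\<^sub>R E ((\<lambda>s. \<phi> (p s)) -` {c}) x)"
    by (simp add: E_eq scaleR_sum_right)
  finally show ?thesis
    by (simp add: simple_spectral_integral_def image_image)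
qed

lemma simple_int_diff:
  assumes "simple_function borel \<sigma>" "simple_function borel \<tau>"
  shows "simple_int (\<lambda>s. \<sigma> s - \<tau> s) x = simple_int \<sigma> x - simple_int \<tau> x"
proof -
  let ?p = "\<lambda>s. (\<sigma> s, \<tau> s)"
  have p: "simple_function borel ?p" using assms by (rule simple_function_Pair)
  show ?thesis
    using simple_int_partition[OF p, of fst x] simple_int_partition[OF p, of snd x]
      simple_int_partition[OF p, of "\<lambda>(a, b). a - b" x]
    by (simp add: sum_subtractf[symmetric] scaleR_diff_left case_prod_beta)
qed

lemma simple_int_const: "simple_int (\<lambda>s. c) x = c *\<^sub>R x"
proof -
  have "(\<lambda>s::real. c) -` {c} = UNIV" by auto
  then show ?thesis by (simp add: simple_spectral_integral_def)
qed

lemma simple_int_add_right: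
  assumes "simple_function borel \<sigma>"
  shows "simple_int \<sigma> (x + y) = simple_int \<sigma> x + simple_int \<sigma> y"
  using simple_borelD[OF assms]
  by (simp add: simple_spectral_integral_def E_add scaleR_add_right sum.distrib)

lemma simple_int_scaleC:
  assumes "simple_function borel \<sigma>"
  shows "simple_int \<sigma> (c *\<^sub>C x) = c *\<^sub>C simple_int \<sigma> x"
  using simple_borelD[OF assms]
  by (simp add: simple_spectral_integral_def E_scaleC linear_sum[OF linear_scaleC] scaleC_scaleR)

lemma simple_int_sym:
  assumes "simple_function borel \<sigma>"
  shows "cinner (simple_int \<sigma> x) y = cinner x (simple_int \<sigma> y)"
  using simple_borelD[OF assms]
  by (simp add: simple_spectral_integral_def cinner_sum_left cinner_sum_right
      cinner_scaleR_left cinner_scaleR_right E_sym)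

lemma simple_int_E:
  assumes "simple_function borel \<sigma>" "B \<in> sets borel"
  shows "simple_int \<sigma> (E B x) = E B (simple_int \<sigma> x)"
  using simple_borelD[OF assms(1)] assms(2)
  by (simp add: simple_spectral_integral_def linear_sum[OF linear_E] linear_scale[OF linear_E]
      E_Int Int_commute)

lemma integrable_simple_sq:
  assumes "simple_function borel \<sigma>"
  shows "integrable (M x) (\<lambda>s. (\<sigma> s)\<^sup>2 :: real)"
proof -
  have [measurable]: "\<sigma> \<in> borel_measurable borel" by (rule borel_measurable_simple_function[OF assms])
  have "finite (\<sigma> ` UNIV)" using simple_borelD[OF assms] by simp
  then obtain K where "\<And>s. norm (\<sigma> s) \<le> K"
    by (metis finite_imp_bounded bounded_iff rangeI)
  then have "\<And>s. norm ((\<sigma> s)\<^sup>2) \<le> K\<^sup>2"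
    by (metis abs_ge_zero norm_power power_mono real_norm_def)
  then show ?thesis by (intro integrable_const_bound[of _ "K\<^sup>2"]) auto
qed

text \<open>Pythagoras: the pieces of \<open>x\<close> belonging to distinct level sets are
  orthogonal, and their squared norms are the masses of these sets under \<open>M x\<close>.\<close>

lemma norm_simple_int_sq:
  assumes \<sigma>: "simple_function borel \<sigma>"
  shows "(norm (simple_int \<sigma> x))\<^sup>2 = (\<integral>s. (\<sigma> s)\<^sup>2 \<partial>M x)"
proof -
  note fin = simple_borelD(1)[OF \<sigma>] and B = simple_borelD(2)[OF \<sigma>]
  let ?e = "\<lambda>c. E (\<sigma> -` {c}) x"
  have orth: "cinner (?e c) (?e d) = (if d = c then of_real ((norm (?e c))\<^sup>2) else 0)" for c d
  proof (cases "d = c")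
    case False
    then have "E (\<sigma> -` {c}) (?e d) = 0" by (intro E_disjoint B) auto
    then show ?thesis using False by (simp add: E_sym B)
  qed (simp add: cinner_self)
  have "cinner (simple_int \<sigma> x) (simple_int \<sigma> x) = (\<Sum>c\<in>range \<sigma>. of_real (c\<^sup>2 * (norm (?e c))\<^sup>2))"
    using fin
    by (simp add: simple_spectral_integral_def cinner_sum_left cinner_sum_right cinner_scaleR_left
        cinner_scaleR_right orth if_distrib[of "\<lambda>z. _ * z"] sum.delta' power2_eq_square mult.assoc
        cong: if_cong)
  then have "(norm (simple_int \<sigma> x))\<^sup>2 = (\<Sum>c\<in>range \<sigma>. c\<^sup>2 * (norm (?e c))\<^sup>2)"
    by (simp add: norm_sq_cinner)
  also have "\<dots> = (\<Sum>c\<in>range \<sigma>. \<integral>s. c\<^sup>2 * indicator (\<sigma> -` {c}) s \<partial>M x)"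
    by (simp add: measure_M B)
  also have "\<dots> = (\<integral>s. (\<Sum>c\<in>range \<sigma>. c\<^sup>2 * indicator (\<sigma> -` {c}) s) \<partial>M x)"
    using B by (intro Bochner_Integration.integral_sum[symmetric] integrable_mult_right)
       (auto simp: less_top[symmetric])
  also have "(\<lambda>s. \<Sum>c\<in>range \<sigma>. c\<^sup>2 * indicator (\<sigma> -` {c}) s) = (\<lambda>s. (\<sigma> s)\<^sup>2)"
  proof
    fix s
    have "(\<Sum>c\<in>range \<sigma>. c\<^sup>2 * indicator (\<sigma> -` {c}) s) = (\<Sum>c\<in>range \<sigma>. if c = \<sigma> s then c\<^sup>2 else 0)"
      by (intro sum.cong) (auto simp: indicator_def)
    then show "(\<Sum>c\<in>range \<sigma>. c\<^sup>2 * indicator (\<sigma> -` {c}) s) = (\<sigma> s)\<^sup>2"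
      using fin by simp
  qed
  finally show ?thesis .
qed

lemma norm_simple_int_diff_sq:
  assumes "simple_function borel \<sigma>" "simple_function borel \<tau>"
  shows "(norm (simple_int \<sigma> x - simple_int \<tau> x))\<^sup>2 = (\<integral>s. (\<sigma> s - \<tau> s)\<^sup>2 \<partial>M x)"
  using norm_simple_int_sq[OF simple_function_diff[OF assms]] assms
  by (simp add: simple_int_diff)

section \<open>Extension from simple to measurable functions by square-integrable
  approximation\<close>

text \<open>One such sequence computes \<open>\<integral> g dE\<close> at all points of its domain simultaneously.\<close>

definition approx_seq :: "(real \<Rightarrow> real) \<Rightarrow> (nat \<Rightarrow> real \<Rightarrow> real) \<Rightarrow> bool" where
  "approx_seq g \<sigma> \<longleftrightarrow> (\<forall>n. simple_function borel (\<sigma> n)) \<and>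
     (\<forall>s. (\<lambda>n. \<sigma> n s) \<longlonglongrightarrow> g s) \<and> (\<forall>n s. \<bar>\<sigma> n s\<bar> \<le> 2 * \<bar>g s\<bar>)"

lemma approx_seq_exists:
  assumes "g \<in> borel_measurable borel"
  obtains \<sigma> where "approx_seq g \<sigma>"
proof -
  obtain \<sigma> where "(\<forall>i. simple_function borel (\<sigma> i)) \<and> (\<forall>x\<in>space borel. (\<lambda>i. \<sigma> i x) \<longlonglongrightarrow> g x) \<and>
    (\<forall>i. \<forall>x\<in>space borel. dist (\<sigma> i x) 0 \<le> 2 * dist (g x) 0)"
    using borel_measurable_implies_sequence_metric[OF assms, of 0] by blast
  then show thesis by (intro that[of \<sigma>]) (auto simp: approx_seq_def)
qed

lemma square_diff_le: "(a - b)\<^sup>2 \<le> 2 * a\<^sup>2 + 2 * (b::real)\<^sup>2"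
  using zero_le_power2[of "a + b"] by (simp add: power2_sum power2_diff)

lemma approx_seq_L2:
  assumes g[measurable]: "g \<in> borel_measurable borel" and int: "integrable (M x) (\<lambda>s. (g s)\<^sup>2)"
    and \<sigma>: "approx_seq g \<sigma>" and \<tau>: "simple_function borel \<tau>"
  shows "(\<lambda>n. \<integral>s. (\<sigma> n s - \<tau> s)\<^sup>2 \<partial>M x) \<longlonglongrightarrow> (\<integral>s. (g s - \<tau> s)\<^sup>2 \<partial>M x)"
    and "(\<lambda>n. \<integral>s. (\<sigma> n s - g s)\<^sup>2 \<partial>M x) \<longlonglongrightarrow> 0"
proof -
  have [measurable]: "\<tau> \<in> borel_measurable borel" "\<And>n. \<sigma> n \<in> borel_measurable borel"
    using \<sigma> \<tau> by (auto simp: approx_seq_def intro: borel_measurable_simple_function)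
  have lim: "(\<lambda>n. \<sigma> n s) \<longlonglongrightarrow> g s" for s using \<sigma> by (simp add: approx_seq_def)
  \<comment> \<open>Together with \<open>square_diff_le\<close> the factor 4 yields the dominating
    functions below: 8 = 2 * 4 for \<sigma> - \<tau>, and 10 = 2 * 4 + 2 for \<sigma> - g.\<close>
  have sq: "(\<sigma> n s)\<^sup>2 \<le> 4 * (g s)\<^sup>2" for n s
  proof -
    have "(\<sigma> n s)\<^sup>2 \<le> (2 * \<bar>g s\<bar>)\<^sup>2"
      using \<sigma> unfolding approx_seq_def by (metis abs_ge_zero power2_abs power_mono)
    then show ?thesis by (simp add: power_mult_distrib)
  qed
  note [simp] = integrable_simple_sq[OF \<tau>] int
  show "(\<lambda>n. \<integral>s. (\<sigma> n s - \<tau> s)\<^sup>2 \<partial>M x) \<longlonglongrightarrow> (\<integral>s. (g s - \<tau> s)\<^sup>2 \<partial>M x)"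
  proof (rule integral_dominated_convergence[where w = "\<lambda>s. 8 * (g s)\<^sup>2 + 2 * (\<tau> s)\<^sup>2"])
    show "AE s in M x. (\<lambda>n. (\<sigma> n s - \<tau> s)\<^sup>2) \<longlonglongrightarrow> (g s - \<tau> s)\<^sup>2"
      by (intro always_eventually allI tendsto_intros lim)
    show "AE s in M x. norm ((\<sigma> n s - \<tau> s)\<^sup>2) \<le> 8 * (g s)\<^sup>2 + 2 * (\<tau> s)\<^sup>2" for n
    proof (intro always_eventually allI)
      fix s show "norm ((\<sigma> n s - \<tau> s)\<^sup>2) \<le> 8 * (g s)\<^sup>2 + 2 * (\<tau> s)\<^sup>2"
        using square_diff_le[of "\<sigma> n s" "\<tau> s"] sq[of n s] by simp
    qed
  qed auto
  have "(\<lambda>n. \<integral>s. (\<sigma> n s - g s)\<^sup>2 \<partial>M x) \<longlonglongrightarrow> (\<integral>s. 0 \<partial>M x)"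
  proof (rule integral_dominated_convergence[where w = "\<lambda>s. 10 * (g s)\<^sup>2"])
    show "AE s in M x. (\<lambda>n. (\<sigma> n s - g s)\<^sup>2) \<longlonglongrightarrow> 0"
    proof (intro always_eventually allI)
      fix s show "(\<lambda>n. (\<sigma> n s - g s)\<^sup>2) \<longlonglongrightarrow> 0"
        using tendsto_power[OF tendsto_diff[OF lim[of s] tendsto_const[of "g s"]], of 2] by simp
    qed
    show "AE s in M x. norm ((\<sigma> n s - g s)\<^sup>2) \<le> 10 * (g s)\<^sup>2" for n
    proof (intro always_eventually allI)
      fix s show "norm ((\<sigma> n s - g s)\<^sup>2) \<le> 10 * (g s)\<^sup>2"
        using square_diff_le[of "\<sigma> n s" "g s"] sq[of n s] by simp
    qed
  qed auto
  then show "(\<lambda>n. \<integral>s. (\<sigma> n s - g s)\<^sup>2 \<partial>M x) \<longlonglongrightarrow> 0" by simp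
qed

text \<open>This evaluates the definite description in \<open>spectral_integral\<close>. A limit
  must exist and must not depend on the approximating sequence; the estimate \<open>close\<close>
  gives both, once for \<sigma> against itself and once for \<sigma> against a competitor
  \<tau>.\<close>

lemma spectral_integral_approx:
  assumes g[measurable]: "g \<in> borel_measurable borel" and int: "integrable (M x) (\<lambda>s. (g s)\<^sup>2)"
    and \<sigma>: "approx_seq g \<sigma>"
  shows "(\<lambda>n. simple_int (\<sigma> n) x) \<longlonglongrightarrow> the (spectral_integral E g x)"
proof -
  have simple: "simple_function borel (\<sigma> n)" for n using \<sigma> by (simp add: approx_seq_def)
  define D where "D \<rho> n = (\<integral>s. (\<rho> n s - g s)\<^sup>2 \<partial>M x)" for \<rho> :: "nat \<Rightarrow> real \<Rightarrow> real" and n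
  have D\<sigma>: "D \<sigma> \<longlonglongrightarrow> 0" unfolding D_def by (rule approx_seq_L2[OF g int \<sigma> simple])
  have close: "(norm (simple_int (\<rho> m) x - simple_int (\<tau> n) x))\<^sup>2 \<le> 2 * D \<rho> m + 2 * D \<tau> n"
    if \<rho>: "\<And>n. simple_function borel (\<rho> n)" and \<tau>: "\<And>n. simple_function borel (\<tau> n)" for \<rho> \<tau> m n
  proof -
    have int_diff: "integrable (M x) (\<lambda>s. (\<rho> s - g s)\<^sup>2)" if "simple_function borel \<rho>" for \<rho>
    proof (rule Bochner_Integration.integrable_bound)
      show "integrable (M x) (\<lambda>s. 2 * (\<rho> s)\<^sup>2 + 2 * (g s)\<^sup>2)"
        using integrable_simple_sq[OF that] int by simp
      show "(\<lambda>s. (\<rho> s - g s)\<^sup>2) \<in> borel_measurable (M x)"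
        using borel_measurable_simple_function[OF that] by measurable
      show "AE s in M x. norm ((\<rho> s - g s)\<^sup>2) \<le> norm (2 * (\<rho> s)\<^sup>2 + 2 * (g s)\<^sup>2)"
        using square_diff_le by auto
    qed
    have "(norm (simple_int (\<rho> m) x - simple_int (\<tau> n) x))\<^sup>2 = (\<integral>s. (\<rho> m s - \<tau> n s)\<^sup>2 \<partial>M x)"
      by (rule norm_simple_int_diff_sq[OF \<rho> \<tau>])
    also have "\<dots> \<le> (\<integral>s. 2 * (\<rho> m s - g s)\<^sup>2 + 2 * (\<tau> n s - g s)\<^sup>2 \<partial>M x)"
    proof (rule integral_mono)
      show "integrable (M x) (\<lambda>s. (\<rho> m s - \<tau> n s)\<^sup>2)"
        using integrable_simple_sq[OF simple_function_diff[OF \<rho> \<tau>]] .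
      show "integrable (M x) (\<lambda>s. 2 * (\<rho> m s - g s)\<^sup>2 + 2 * (\<tau> n s - g s)\<^sup>2)"
        using int_diff[OF \<rho>] int_diff[OF \<tau>] by simp
      show "(\<rho> m s - \<tau> n s)\<^sup>2 \<le> 2 * (\<rho> m s - g s)\<^sup>2 + 2 * (\<tau> n s - g s)\<^sup>2" for s
        using square_diff_le[of "\<rho> m s - g s" "\<tau> n s - g s"] by simp
    qed
    also have "\<dots> = 2 * D \<rho> m + 2 * D \<tau> n"
      using int_diff[OF \<rho>] int_diff[OF \<tau>] by (simp add: D_def)
    finally show ?thesis .
  qed
  have "Cauchy (\<lambda>n. simple_int (\<sigma> n) x)"
  proof (rule CauchyI)
    fix e :: real assume e: "0 < e"
    have "\<forall>\<^sub>F n in sequentially. D \<sigma> n < e\<^sup>2 / 4"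
      by (rule order_tendstoD(2)[OF D\<sigma>]) (use e in simp)
    then obtain N where N: "\<And>n. n \<ge> N \<Longrightarrow> D \<sigma> n < e\<^sup>2 / 4" by (auto simp: eventually_sequentially)
    have "norm (simple_int (\<sigma> m) x - simple_int (\<sigma> n) x) < e" if "m \<ge> N" "n \<ge> N" for m n
    proof (rule power2_less_imp_less)
      show "(norm (simple_int (\<sigma> m) x - simple_int (\<sigma> n) x))\<^sup>2 < e\<^sup>2"
        using close[of \<sigma> \<sigma> m n, OF simple simple] N[OF that(1)] N[OF that(2)] by simp
    qed (use e in simp)
    then show "\<exists>N. \<forall>m\<ge>N. \<forall>n\<ge>N. norm (simple_int (\<sigma> m) x - simple_int (\<sigma> n) x) < e" by blast
  qed
  then obtain y where y: "(\<lambda>n. simple_int (\<sigma> n) x) \<longlonglongrightarrow> y"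
    using Cauchy_convergent convergent_def by blast
  have "(THE y. \<exists>\<sigma> :: nat \<Rightarrow> real \<Rightarrow> real.
             (\<forall>n. simple_function borel (\<sigma> n)) \<and>
             (\<lambda>n. \<integral>s. (\<sigma> n s - g s)\<^sup>2 \<partial>M x) \<longlonglongrightarrow> 0 \<and>
             (\<lambda>n. simple_int (\<sigma> n) x) \<longlonglongrightarrow> y) = y"
  proof (rule the_equality)
    show "\<exists>\<sigma>. (\<forall>n. simple_function borel (\<sigma> n)) \<and>
      (\<lambda>n. \<integral>s. (\<sigma> n s - g s)\<^sup>2 \<partial>M x) \<longlonglongrightarrow> 0 \<and> (\<lambda>n. simple_int (\<sigma> n) x) \<longlonglongrightarrow> y"
      using simple D\<sigma> y unfolding D_def by blast
  next
    fix z assume "\<exists>\<sigma>. (\<forall>n. simple_function borel (\<sigma> n)) \<and>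
      (\<lambda>n. \<integral>s. (\<sigma> n s - g s)\<^sup>2 \<partial>M x) \<longlonglongrightarrow> 0 \<and> (\<lambda>n. simple_int (\<sigma> n) x) \<longlonglongrightarrow> z"
    then obtain \<tau> where \<tau>: "\<And>n. simple_function borel (\<tau> n)" "D \<tau> \<longlonglongrightarrow> 0"
      "(\<lambda>n. simple_int (\<tau> n) x) \<longlonglongrightarrow> z" unfolding D_def by blast
    have "(\<lambda>n. (norm (simple_int (\<tau> n) x - simple_int (\<sigma> n) x))\<^sup>2) \<longlonglongrightarrow> (norm (z - y))\<^sup>2"
      by (intro tendsto_intros \<tau> y)
    moreover have "(\<lambda>n. 2 * D \<tau> n + 2 * D \<sigma> n) \<longlonglongrightarrow> 2 * 0 + 2 * 0"
      by (intro tendsto_intros \<tau> D\<sigma>)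
    ultimately have "(norm (z - y))\<^sup>2 \<le> 2 * 0 + 2 * 0"
      by (rule LIMSEQ_le) (intro exI[of _ 0] allI impI close \<tau>(1) simple)
    then show "z = y" by simp
  qed
  then have "spectral_integral E g x = Some y" using int by (simp add: spectral_integral_def)
  then show ?thesis using y by simp
qed

lemma dom_spectral_integral:
  "x \<in> dom (spectral_integral E g) \<longleftrightarrow> integrable (M x) (\<lambda>s. (g s)\<^sup>2)"
  by (auto simp: spectral_integral_def split: if_splits)

text \<open>Square integrability refers to a measure depending on \<open>x\<close>, which is awkward
  for sums of vectors. Boundedness of the approximations visibly survives sums and multiples, and
  one sequence \<sigma> serves all vectors. The isometry and Fatou's lemma lead from boundedness
  back to integrability.\<close>

lemma dom_spectral_integral_Bseq:
  assumes g[measurable]: "g \<in> borel_measurable borel" and \<sigma>: "approx_seq g \<sigma>"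
  shows "x \<in> dom (spectral_integral E g) \<longleftrightarrow> Bseq (\<lambda>n. simple_int (\<sigma> n) x)"
proof
  assume "x \<in> dom (spectral_integral E g)"
  then show "Bseq (\<lambda>n. simple_int (\<sigma> n) x)"
    using spectral_integral_approx[OF g _ \<sigma>]
    by (metis dom_spectral_integral convergent_def convergent_imp_Bseq)
next
  assume "Bseq (\<lambda>n. simple_int (\<sigma> n) x)"
  then obtain K where K: "\<And>n. norm (simple_int (\<sigma> n) x) \<le> K" by (auto simp: Bseq_def)
  have simple: "simple_function borel (\<sigma> n)" for n using \<sigma> by (simp add: approx_seq_def)
  have [measurable]: "\<sigma> n \<in> borel_measurable borel" for n
    using simple by (rule borel_measurable_simple_function)
  have bound: "(\<integral>\<^sup>+s. ennreal ((\<sigma> n s)\<^sup>2) \<partial>M x) \<le> ennreal (K\<^sup>2)" for n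
    using integrable_simple_sq[OF simple] K[of n]
    by (subst nn_integral_eq_integral)
      (auto simp: norm_simple_int_sq[OF simple, symmetric] intro!: ennreal_leI power_mono)
  have "(\<integral>\<^sup>+s. ennreal ((g s)\<^sup>2) \<partial>M x) = (\<integral>\<^sup>+s. liminf (\<lambda>n. ennreal ((\<sigma> n s)\<^sup>2)) \<partial>M x)"
  proof (rule nn_integral_cong)
    fix s
    have "(\<lambda>n. \<sigma> n s) \<longlonglongrightarrow> g s" using \<sigma> by (simp add: approx_seq_def)
    then have "(\<lambda>n. ennreal ((\<sigma> n s)\<^sup>2)) \<longlonglongrightarrow> ennreal ((g s)\<^sup>2)"
      by (intro tendsto_ennrealI tendsto_power)
    then show "ennreal ((g s)\<^sup>2) = liminf (\<lambda>n. ennreal ((\<sigma> n s)\<^sup>2))"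
      by (intro lim_imp_Liminf[symmetric]) simp_all
  qed
  also have "\<dots> \<le> liminf (\<lambda>n. \<integral>\<^sup>+s. ennreal ((\<sigma> n s)\<^sup>2) \<partial>M x)"
    by (rule nn_integral_liminf) simp
  also have "\<dots> \<le> liminf (\<lambda>n. ennreal (K\<^sup>2))"
    by (rule Liminf_mono) (simp add: bound)
  also have "\<dots> < \<infinity>" by (simp add: Liminf_const)
  finally show "x \<in> dom (spectral_integral E g)"
    by (simp add: dom_spectral_integral integrable_iff_bounded)
qed

lemma linear_operator_spectral_integral:
  assumes g[measurable]: "g \<in> borel_measurable borel"
  shows "linear_operator (spectral_integral E g)"
proof -
  obtain \<sigma> where \<sigma>: "approx_seq g \<sigma>" using approx_seq_exists[OF g] .
  have simple: "simple_function borel (\<sigma> n)" for n using \<sigma> by (simp add: approx_seq_def)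
  note dom = dom_spectral_integral_Bseq[OF g \<sigma>]
  have lim: "(\<lambda>n. simple_int (\<sigma> n) x) \<longlonglongrightarrow> the (spectral_integral E g x)"
    if "x \<in> dom (spectral_integral E g)" for x
    using that by (intro spectral_integral_approx[OF g _ \<sigma>]) (simp add: dom_spectral_integral)
  have add: "x + y \<in> dom (spectral_integral E g)"
    if "x \<in> dom (spectral_integral E g)" "y \<in> dom (spectral_integral E g)" for x y
    using tendsto_add[OF that[THEN lim], THEN convergentI, THEN convergent_imp_Bseq]
    by (simp only: dom simple_int_add_right[OF simple])
  have scale: "c *\<^sub>C x \<in> dom (spectral_integral E g)"
    if "x \<in> dom (spectral_integral E g)" for x c
    using bounded_linear.tendsto[OF bounded_linear_scaleC lim[OF that], THEN convergentI, THEN convergent_imp_Bseq]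
    by (simp only: dom simple_int_scaleC[OF simple])
  have zero: "0 \<in> dom (spectral_integral E g)"
    using simple_int_scaleC[OF simple, of _ 0 0] by (simp only: dom) simp
  have "the (spectral_integral E g (x + y)) = the (spectral_integral E g x) + the (spectral_integral E g y)"
    if "x \<in> dom (spectral_integral E g)" "y \<in> dom (spectral_integral E g)" for x y
    using LIMSEQ_unique[OF lim[OF add[OF that]]] tendsto_add[OF that[THEN lim]]
    by (simp add: simple_int_add_right[OF simple])
  moreover have "the (spectral_integral E g (c *\<^sub>C x)) = c *\<^sub>C the (spectral_integral E g x)"
    if "x \<in> dom (spectral_integral E g)" for x c
    using LIMSEQ_unique[OF lim[OF scale[OF that]]] bounded_linear.tendsto[OF bounded_linear_scaleC lim[OF that]]
    by (simp add: simple_int_scaleC[OF simple])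
  ultimately show ?thesis
    using add scale zero by (simp add: linear_operator_def csubspace_def clinear_on_def)
qed

lemma spectral_integral_sym:
  assumes g[measurable]: "g \<in> borel_measurable borel"
    and x: "x \<in> dom (spectral_integral E g)" and y: "y \<in> dom (spectral_integral E g)"
  shows "cinner (the (spectral_integral E g x)) y = cinner x (the (spectral_integral E g y))"
proof -
  obtain \<sigma> where \<sigma>: "approx_seq g \<sigma>" using approx_seq_exists[OF g] .
  have simple: "simple_function borel (\<sigma> n)" for n using \<sigma> by (simp add: approx_seq_def)
  note lim = spectral_integral_approx[OF g _ \<sigma>] and int = dom_spectral_integral[THEN iffD1]
  have "(\<lambda>n. cinner (simple_int (\<sigma> n) x) y) \<longlonglongrightarrow> cinner (the (spectral_integral E g x)) y"
    by (intro tendsto_cinner lim int x tendsto_const)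
  moreover have "(\<lambda>n. cinner (simple_int (\<sigma> n) x) y) \<longlonglongrightarrow> cinner x (the (spectral_integral E g y))"
    unfolding simple_int_sym[OF simple]
    by (intro tendsto_cinner lim int y tendsto_const)
  ultimately show ?thesis by (rule LIMSEQ_unique)
qed

lemma spectral_integral_E:
  assumes g[measurable]: "g \<in> borel_measurable borel" and B: "B \<in> sets borel"
    and x: "x \<in> dom (spectral_integral E g)" and EBx: "E B x \<in> dom (spectral_integral E g)"
  shows "the (spectral_integral E g (E B x)) = E B (the (spectral_integral E g x))"
proof -
  obtain \<sigma> where \<sigma>: "approx_seq g \<sigma>" using approx_seq_exists[OF g] .
  have simple: "simple_function borel (\<sigma> n)" for n using \<sigma> by (simp add: approx_seq_def)
  note lim = spectral_integral_approx[OF g _ \<sigma>] and int = dom_spectral_integral[THEN iffD1]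
  have "(\<lambda>n. E B (simple_int (\<sigma> n) x)) \<longlonglongrightarrow> E B (the (spectral_integral E g x))"
    by (intro bounded_linear.tendsto[OF bounded_linear_E] lim int x B)
  moreover have "(\<lambda>n. E B (simple_int (\<sigma> n) x)) \<longlonglongrightarrow> the (spectral_integral E g (E B x))"
    using lim[OF int[OF EBx]] by (simp add: simple_int_E[OF simple B])
  ultimately show ?thesis by (rule LIMSEQ_unique[symmetric])
qed

text \<open>The isometry passes to the limit in its first argument. With a constant \<tau> it
  measures how far \<open>x\<close> is from being an eigenvector.\<close>

lemma norm_spectral_integral_diff_sq:
  assumes g[measurable]: "g \<in> borel_measurable borel" and \<tau>: "simple_function borel \<tau>"
    and x: "x \<in> dom (spectral_integral E g)"
  shows "(norm (the (spectral_integral E g x) - simple_int \<tau> x))\<^sup>2 = (\<integral>s. (g s - \<tau> s)\<^sup>2 \<partial>M x)"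
proof -
  obtain \<sigma> where \<sigma>: "approx_seq g \<sigma>" using approx_seq_exists[OF g] .
  have simple: "simple_function borel (\<sigma> n)" for n using \<sigma> by (simp add: approx_seq_def)
  have int: "integrable (M x) (\<lambda>s. (g s)\<^sup>2)" using x by (simp add: dom_spectral_integral)
  have "(\<lambda>n. (norm (simple_int (\<sigma> n) x - simple_int \<tau> x))\<^sup>2)
      \<longlonglongrightarrow> (norm (the (spectral_integral E g x) - simple_int \<tau> x))\<^sup>2"
    by (intro tendsto_intros spectral_integral_approx[OF g int \<sigma>])
  then show ?thesis
    using approx_seq_L2(1)[OF g int \<sigma> \<tau>] unfolding norm_simple_int_diff_sq[OF simple \<tau>]
    by (rule LIMSEQ_unique)
qed

lemma norm_spectral_integral_sq:
  assumes g[measurable]: "g \<in> borel_measurable borel"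
    and x: "x \<in> dom (spectral_integral E g)"
  shows "(norm (the (spectral_integral E g x)))\<^sup>2 = (\<integral>s. (g s)\<^sup>2 \<partial>M x)"
  using norm_spectral_integral_diff_sq[OF g simple_function_const x, of 0]
  by (simp add: simple_int_const)

section \<open>Vectors localised in a Borel set, null sets of \<open>E\<close>, and
  truncation\<close>

lemma AE_in:
  assumes B: "B \<in> sets borel" and x: "E B x = x"
  shows "AE s in M x. s \<in> B"
proof (rule AE_I)
  have "E (- B) x = E (- B) (E B x)" by (simp add: x)
  also have "\<dots> = 0" using B by (intro E_disjoint) auto
  finally show "emeasure (M x) (- B) = 0" using B by (simp add: emeasure_M)
qed (use B in auto)

text \<open>\<open>M x\<close> is concentrated on \<open>B\<close>, so the isometry turns the
  pointwise bound on \<open>B\<close> into a norm bound. With g the identity and \<open>B\<close> a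
  small ball it produces the quasi-eigenvectors of A; with c = 0 it bounds the operators restricted
  to the range of \<open>E B\<close>.\<close>

lemma spectral_integral_near_const:
  assumes g[measurable]: "g \<in> borel_measurable borel" and B: "B \<in> sets borel" and x: "E B x = x"
    and bound: "\<And>s. s \<in> B \<Longrightarrow> \<bar>g s - c\<bar> \<le> \<epsilon>" and \<epsilon>: "0 \<le> \<epsilon>"
  shows "x \<in> dom (spectral_integral E g)"
    and "norm (the (spectral_integral E g x) - c *\<^sub>R x) \<le> \<epsilon> * norm x"
proof -
  have AE: "AE s in M x. s \<in> B" by (rule AE_in[OF B x])
  have "AE s in M x. norm ((g s)\<^sup>2) \<le> (\<epsilon> + \<bar>c\<bar>)\<^sup>2"
    using AE
  proof eventually_elim
    case (elim s)
    have "\<bar>g s\<bar> \<le> \<epsilon> + \<bar>c\<bar>" using bound[OF elim] by linarith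
    then show ?case by (metis abs_ge_zero norm_power power_mono real_norm_def)
  qed
  then have "integrable (M x) (\<lambda>s. (g s)\<^sup>2)"
    by (intro integrable_const_bound[of _ "(\<epsilon> + \<bar>c\<bar>)\<^sup>2"]) auto
  then show x': "x \<in> dom (spectral_integral E g)" by (simp add: dom_spectral_integral)
  have le: "AE s in M x. (g s - c)\<^sup>2 \<le> \<epsilon>\<^sup>2"
    using AE by eventually_elim (metis abs_ge_zero bound power2_abs power_mono)
  have "(norm (the (spectral_integral E g x) - c *\<^sub>R x))\<^sup>2 = (\<integral>s. (g s - c)\<^sup>2 \<partial>M x)"
    using norm_spectral_integral_diff_sq[OF g simple_function_const x'] by (simp add: simple_int_const)
  also have "\<dots> \<le> (\<integral>s. \<epsilon>\<^sup>2 \<partial>M x)"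
    using le by (intro integral_mono_AE integrable_const_bound[of _ "\<epsilon>\<^sup>2"]) auto
  also have "\<dots> = (\<epsilon> * norm x)\<^sup>2" by (simp add: measure_M power_mult_distrib mult.commute)
  finally show "norm (the (spectral_integral E g x) - c *\<^sub>R x) \<le> \<epsilon> * norm x"
    by (rule power2_le_imp_le) (simp add: \<epsilon>)
qed

lemma spectral_integral_bounded:
  assumes g[measurable]: "g \<in> borel_measurable borel" and B: "B \<in> sets borel" and x: "E B x = x"
    and bound: "\<And>s. s \<in> B \<Longrightarrow> \<bar>g s\<bar> \<le> K" and K: "0 \<le> K"
  shows "x \<in> dom (spectral_integral E g)"
    and "norm (the (spectral_integral E g x)) \<le> K * norm x"
  using spectral_integral_near_const[OF g B x, of 0 K] bound K by simp_all

text \<open>The null neighbourhoods may be uncountably many, while \<open>E\<close> is only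
  countably additive; the Lindelof property extracts a countable subfamily with the same
  union.\<close>

lemma E_null_if_locally_null:
  assumes V: "\<And>s. s \<in> V \<Longrightarrow> \<exists>U. open U \<and> s \<in> U \<and> (\<forall>x. E U x = 0)"
  obtains W where "open W" "V \<subseteq> W" "\<And>x. E W x = 0"
proof -
  define F where "F = {U. open U \<and> (\<forall>x. E U x = 0)}"
  obtain F' where F': "F' \<subseteq> F" "countable F'" "\<Union>F' = \<Union>F"
    by (rule Lindelof[of F]) (auto simp: F_def)
  have "E (\<Union>F') x = 0" for x
  proof -
    have U: "U \<in> sets borel" "emeasure (M x) U = 0" if "U \<in> F'" for U
    proof -
      have "open U" "E U x = 0" using that F' by (auto simp: F_def)
      then show "U \<in> sets borel" "emeasure (M x) U = 0" by (simp_all add: emeasure_M)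
    qed
    have "(\<Union>U\<in>F'. U) \<in> null_sets (M x)"
      by (rule null_sets_UN') (use F' U in \<open>auto simp: null_sets_def\<close>)
    then show ?thesis by (auto simp: null_sets_def emeasure_M)
  qed
  moreover have "open (\<Union>F')" using F' by (auto simp: F_def)
  moreover have "V \<subseteq> \<Union>F'"
  proof
    fix s assume "s \<in> V"
    then obtain U where "U \<in> F" "s \<in> U" using V unfolding F_def by blast
    then show "s \<in> \<Union>F'" unfolding F'(3) by blast
  qed
  ultimately show thesis by (intro that)
qed

text \<open>Continuity of \<open>M x\<close> from below gives convergence of the norms, and
  Pythagoras for \<open>E B x\<close> and \<open>x - E B x\<close> upgrades it to convergence of the
  vectors.\<close>

lemma E_interval_tendsto: "(\<lambda>n. E {- real n..<real n} x) \<longlonglongrightarrow> x"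
proof -
  let ?B = "\<lambda>n. {- real n..<real n}"
  have UN: "(\<Union>n. ?B n) = UNIV"
  proof -
    have "s \<in> (\<Union>n. ?B n)" for s
      using reals_Archimedean2[of "\<bar>s\<bar>"] by (auto simp: abs_less_iff) (metis less_eq_real_def minus_less_iff)
    then show ?thesis by auto
  qed
  have inc: "incseq ?B" by (auto simp: incseq_def)
  have "(\<lambda>n. measure (M x) (?B n)) \<longlonglongrightarrow> measure (M x) (\<Union>n. ?B n)"
    by (rule finite_Lim_measure_incseq) (use inc in auto)
  then have lim: "(\<lambda>n. (norm (E (?B n) x))\<^sup>2) \<longlonglongrightarrow> (norm x)\<^sup>2"
    by (simp add: UN measure_M)
  have "(norm (E B x - x))\<^sup>2 = (norm x)\<^sup>2 - (norm (E B x))\<^sup>2" if "B \<in> sets borel" for B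
  proof -
    have "(norm (x + - E B x))\<^sup>2 = (norm x)\<^sup>2 - 2 * Re (cinner x (E B x)) + (norm (E B x))\<^sup>2"
      unfolding norm_add_sq by (simp add: cinner_minus_right)
    moreover have "Re (cinner x (E B x)) = (norm (E B x))\<^sup>2"
      using that by (metis E_sym norm_E_sq)
    ultimately show ?thesis by (simp add: norm_minus_commute)
  qed
  then have "(\<lambda>n. (norm (E (?B n) x - x))\<^sup>2) \<longlonglongrightarrow> (norm x)\<^sup>2 - (norm x)\<^sup>2"
    using tendsto_diff[OF tendsto_const lim, of "(norm x)\<^sup>2"] by simp
  then have "(\<lambda>n. sqrt ((norm (E (?B n) x - x))\<^sup>2)) \<longlonglongrightarrow> sqrt 0"
    by (intro tendsto_real_sqrt) simp
  then have "(\<lambda>n. norm (E (?B n) x - x)) \<longlonglongrightarrow> 0" by simp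
  then show ?thesis by (simp add: tendsto_norm_zero_iff LIM_zero_iff)
qed

end

section \<open>Resolvent sets and semigroups\<close>

lemma csubspaceD:
  assumes "csubspace X"
  shows "0 \<in> X" "x \<in> X \<Longrightarrow> y \<in> X \<Longrightarrow> x + y \<in> X" "x \<in> X \<Longrightarrow> c *\<^sub>C x \<in> X"
    "x \<in> X \<Longrightarrow> r *\<^sub>R x \<in> X" "x \<in> X \<Longrightarrow> - x \<in> X" "x \<in> X \<Longrightarrow> y \<in> X \<Longrightarrow> x - y \<in> X"
proof -
  show *: "0 \<in> X" "x \<in> X \<Longrightarrow> y \<in> X \<Longrightarrow> x + y \<in> X" "x \<in> X \<Longrightarrow> c *\<^sub>C x \<in> X" for x y c
    using assms by (auto simp: csubspace_def)
  show **: "x \<in> X \<Longrightarrow> r *\<^sub>R x \<in> X" for x r by (simp add: scaleR_scaleC *)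
  show ***: "x \<in> X \<Longrightarrow> - x \<in> X" for x using **[of x "-1"] by simp
  show "x \<in> X \<Longrightarrow> y \<in> X \<Longrightarrow> x - y \<in> X" for x y using *(2)[of x "- y"] ***[of y] by simp
qed

lemma clinear_onD:
  assumes "clinear_on X T" "csubspace X"
  shows "x \<in> X \<Longrightarrow> y \<in> X \<Longrightarrow> T (x + y) = T x + T y" "x \<in> X \<Longrightarrow> T (c *\<^sub>C x) = c *\<^sub>C T x"
    "T 0 = 0" "x \<in> X \<Longrightarrow> y \<in> X \<Longrightarrow> T (x - y) = T x - T y"
proof -
  show *: "x \<in> X \<Longrightarrow> y \<in> X \<Longrightarrow> T (x + y) = T x + T y" "x \<in> X \<Longrightarrow> T (c *\<^sub>C x) = c *\<^sub>C T x" for x y c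
    using assms by (auto simp: clinear_on_def)
  show "T 0 = 0" using *(2)[of 0 0] csubspaceD[OF assms(2)] by simp
  assume xy: "x \<in> X" "y \<in> X"
  have "T (x + (-1) *\<^sub>C y) = T x + (-1) *\<^sub>C T y"
    using xy csubspaceD[OF assms(2)] by (simp only: *)
  then show "T (x - y) = T x - T y" by (simp add: scaleC_minus_left)
qed

lemma op_linear:
  assumes "linear_operator A"
  shows "x \<in> dom A \<Longrightarrow> y \<in> dom A \<Longrightarrow> the (A (x + y)) = the (A x) + the (A y)"
    "x \<in> dom A \<Longrightarrow> the (A (c *\<^sub>C x)) = c *\<^sub>C the (A x)"
    "the (A 0) = 0"
    "x \<in> dom A \<Longrightarrow> y \<in> dom A \<Longrightarrow> the (A (x - y)) = the (A x) - the (A y)"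
proof -
  have "clinear_on (dom A) (\<lambda>x. the (A x))" "csubspace (dom A)"
    using assms by (simp_all add: linear_operator_def)
  note lin = clinear_onD[OF this]
  show "x \<in> dom A \<Longrightarrow> y \<in> dom A \<Longrightarrow> the (A (x + y)) = the (A x) + the (A y)" by (rule lin(1))
  show "x \<in> dom A \<Longrightarrow> the (A (c *\<^sub>C x)) = c *\<^sub>C the (A x)" by (rule lin(2))
  show "the (A 0) = 0" by (rule lin(3))
  show "x \<in> dom A \<Longrightarrow> y \<in> dom A \<Longrightarrow> the (A (x - y)) = the (A x) - the (A y)" by (rule lin(4))
qed

text \<open>A lower bound for \<open>A - l\<close> survives perturbations of \<open>l\<close> that
  are small against 1 / K; surjectivity is then a fixed point problem for the inverse at
  \<open>l\<close>. This makes the spectrum closed, hence Borel, as the cut-off functions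
  require.\<close>

lemma open_resolvent_set:
  assumes A: "linear_operator A"
  shows "open (resolvent_set A)"
proof (rule openI)
  fix l assume "l \<in> resolvent_set A"
  then obtain K0 where bij: "bij_betw (\<lambda>x. the (A x) - l *\<^sub>C x) (dom A) UNIV"
    and K0: "\<And>x. x \<in> dom A \<Longrightarrow> norm x \<le> K0 * norm (the (A x) - l *\<^sub>C x)"
    by (auto simp: resolvent_set_def)
  \<comment> \<open>\<open>K0\<close> need not be positive, but the radius 1 / (2 * K) must
    be.\<close>
  define K where "K = \<bar>K0\<bar> + 1"
  have Kpos: "K > 0" by (simp add: K_def)
  have K: "norm x \<le> K * norm (the (A x) - l *\<^sub>C x)" if "x \<in> dom A" for x
    using K0[OF that] by (rule order_trans) (intro mult_right_mono, auto simp: K_def)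
  have sub: "csubspace (dom A)" using A by (simp add: linear_operator_def)
  show "\<exists>e>0. ball l e \<subseteq> resolvent_set A"
  proof (intro exI[of _ "1 / (2 * K)"] conjI subsetI)
    fix l' assume "l' \<in> ball l (1 / (2 * K))"
    then have "cmod (l' - l) < 1 / (2 * K)" by (simp add: dist_norm norm_minus_commute)
    then have l': "cmod (l' - l) * K \<le> 1 / 2" using Kpos by (simp add: field_simps)
    have bound: "norm x \<le> (2 * K) * norm (the (A x) - l' *\<^sub>C x)" if x: "x \<in> dom A" for x
    proof -
      have "the (A x) - l *\<^sub>C x = (the (A x) - l' *\<^sub>C x) + (l' - l) *\<^sub>C x"
        by (simp add: scaleC_diff_left)
      then have "norm (the (A x) - l *\<^sub>C x) \<le> norm (the (A x) - l' *\<^sub>C x) + cmod (l' - l) * norm x"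
        by (metis norm_scaleC norm_triangle_ineq)
      then have "norm x \<le> K * (norm (the (A x) - l' *\<^sub>C x) + cmod (l' - l) * norm x)"
        using K[OF x] Kpos by (meson mult_left_mono less_imp_le order_trans)
      also have "\<dots> = K * norm (the (A x) - l' *\<^sub>C x) + (cmod (l' - l) * K) * norm x"
        by (simp add: algebra_simps)
      also have "\<dots> \<le> K * norm (the (A x) - l' *\<^sub>C x) + 1 / 2 * norm x"
        by (intro add_left_mono mult_right_mono l') simp
      finally show ?thesis by simp
    qed
    have "inj_on (\<lambda>x. the (A x) - l' *\<^sub>C x) (dom A)"
    proof (rule inj_onI)
      fix x y assume xy: "x \<in> dom A" "y \<in> dom A" "the (A x) - l' *\<^sub>C x = the (A y) - l' *\<^sub>C y"
      have "the (A (x - y)) - l' *\<^sub>C (x - y) = 0"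
        using xy by (simp add: op_linear[OF A] scaleC_diff_right algebra_simps)
      then show "x = y" using bound[of "x - y"] xy csubspaceD[OF sub] by auto
    qed
    moreover have "y \<in> (\<lambda>x. the (A x) - l' *\<^sub>C x) ` dom A" for y
    proof -
      have "\<exists>x\<in>dom A. the (A x) - l *\<^sub>C x = z" for z
      proof -
        have "z \<in> (\<lambda>x. the (A x) - l *\<^sub>C x) ` dom A"
          using bij_betw_imp_surj_on[OF bij] by simp
        then show ?thesis by auto
      qed
      then obtain R where R: "\<And>z. R z \<in> dom A" "\<And>z. the (A (R z)) - l *\<^sub>C R z = z"
        by metis
      have lip: "dist (y + (l' - l) *\<^sub>C R z) (y + (l' - l) *\<^sub>C R z') \<le> 1 / 2 * dist z z'" for z z'
      proof -
        have "the (A (R z - R z')) - l *\<^sub>C (R z - R z') = z - z'"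
          using R(2)[of z] R(2)[of z']
          by (simp add: op_linear[OF A] R(1) scaleC_diff_right algebra_simps)
        then have "norm (R z - R z') \<le> K * norm (z - z')"
          using K[of "R z - R z'"] R(1) csubspaceD[OF sub] by simp
        then have "cmod (l' - l) * norm (R z - R z') \<le> cmod (l' - l) * (K * norm (z - z'))"
          by (rule mult_left_mono) simp
        also have "\<dots> = (cmod (l' - l) * K) * norm (z - z')" by simp
        also have "\<dots> \<le> 1 / 2 * norm (z - z')" by (intro mult_right_mono l') simp
        finally show ?thesis
          by (simp add: dist_norm scaleC_diff_right[symmetric] norm_scaleC)
      qed
      \<comment> \<open>With x = R z, the equation \<open>A x - l' x = y\<close> reads z = y + (l' -
        l) R z; the radius was chosen to make the right-hand side a contraction with constant
        1/2.\<close>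
      have "\<exists>!z. y + (l' - l) *\<^sub>C R z = z"
        by (rule banach_fix_type[of "1/2"]) (use lip in auto)
      then obtain z where z: "y + (l' - l) *\<^sub>C R z = z" by blast
      have "the (A (R z)) - l' *\<^sub>C R z = y"
        using R(2)[of z] z by (simp add: scaleC_diff_left algebra_simps)
      then show ?thesis by (rule image_eqI[OF sym R(1)])
    qed
    ultimately have "bij_betw (\<lambda>x. the (A x) - l' *\<^sub>C x) (dom A) UNIV"
      by (intro bij_betw_imageI equalityI subset_UNIV subsetI)
    then show "l' \<in> resolvent_set A"
      using bound unfolding resolvent_set_def by blast
  qed (use Kpos in simp)
qed

lemma closed_real_spectrum:
  assumes "linear_operator A"
  shows "closed (real_spectrum A)"
proof -
  have "real_spectrum A = complex_of_real -` (- resolvent_set A)"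
    by (auto simp: real_spectrum_def spectrum_def)
  then show ?thesis
    using open_resolvent_set[OF assms]
    by (auto intro!: continuous_closed_vimage)
qed

section \<open>Orbits of quasi-eigenvectors under a contraction semigroup\<close>

lemma exp_of_real_quotient:
  "((\<lambda>h. (exp (- c * complex_of_real h) - 1) / of_real h) \<longlongrightarrow> - c) (at_right 0)"
proof -
  have "((\<lambda>z. exp (- c * z)) has_field_derivative - c) (at 0)"
    by (auto intro!: derivative_eq_intros)
  then have 1: "((\<lambda>z. (exp (- c * z) - 1) / z) \<longlongrightarrow> - c) (at 0)"
    by (simp add: DERIV_def)
  have 2: "filterlim complex_of_real (at 0) (at_right 0)"
    unfolding filterlim_at
    by (auto simp: eventually_at_right_less intro!: tendsto_eq_intros eventually_at_rightI[of 0 1])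
  show ?thesis using filterlim_compose[OF 1 2] by simp
qed

text \<open>Telescoping \<open>exp (- c t) S(t) z - z\<close> over \<open>n\<close> equal time steps and letting \<open>n\<close> tend to infinity
  replaces the integral in Duhamel's formula.\<close>

lemma semigroup_quasi_eigenvector:
  assumes sg: "contraction_semigroup X N S" and X: "csubspace X"
    and tri: "\<And>x y. x \<in> X \<Longrightarrow> y \<in> X \<Longrightarrow> N (x + y) \<le> N x + N y"
    and hom: "\<And>a x. x \<in> X \<Longrightarrow> N (a *\<^sub>C x) = cmod a * N x"
    and gen: "has_generator_value X N S z y"
    and c: "Re c = 0" and t: "0 < t"
  shows "N z - t * N (y - c *\<^sub>C z) \<le> N (S t z)"
proof -
  note X = csubspaceD[OF X] and Xsub = X
  have S_X: "S t x \<in> X" and S_contr: "N (S t x) \<le> N x" if "0 \<le> t" "x \<in> X" for t x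
    using sg that by (auto simp: contraction_semigroup_def)
  have S_lin: "clinear_on X (S t)" if "0 \<le> t" for t
    using sg that by (auto simp: contraction_semigroup_def)
  have S_add: "S (s + t) x = S s (S t x)" if "0 \<le> s" "0 \<le> t" "x \<in> X" for s t x
    using sg that by (auto simp: contraction_semigroup_def)
  have S_0: "S 0 x = x" if "x \<in> X" for x
    using sg that by (auto simp: contraction_semigroup_def)
  have z: "z \<in> X" and y: "y \<in> X"
    and lim: "((\<lambda>t. N ((1 / t) *\<^sub>R (S t z - z) - y)) \<longlongrightarrow> 0) (at_right 0)"
    using gen by (auto simp: has_generator_value_def)
  \<comment> \<open>Since \<open>Re c = 0\<close>, the factor is unimodular, so \<open>T\<close> is
    again a contraction semigroup; its derivative at \<open>z\<close> is y - c z, the defect of the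
    eigenvalue equation.\<close>
  define e where "e t = exp (- c * complex_of_real t)" for t
  define T where "T t x = e t *\<^sub>C S t x" for t x
  have e1: "cmod (e t) = 1" for t by (simp add: e_def c)
  have e_add: "e (s + t) = e s * e t" for s t by (simp add: e_def exp_add[symmetric] algebra_simps)
  have T_X: "T t x \<in> X" if "0 \<le> t" "x \<in> X" for t x using that by (simp add: T_def X S_X)
  have T_contr: "N (T t x) \<le> N x" if "0 \<le> t" "x \<in> X" for t x
    using that by (simp add: T_def hom S_X e1 S_contr)
  have T_add: "T (s + t) x = T s (T t x)" if "0 \<le> s" "0 \<le> t" "x \<in> X" for s t x
    using that by (simp add: T_def e_add S_add clinear_onD[OF S_lin Xsub] scaleC_scaleC S_X)
  have T_diff: "T s (x - x') = T s x - T s x'" if "0 \<le> s" "x \<in> X" "x' \<in> X" for s x x'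
    using that by (simp add: T_def clinear_onD[OF S_lin Xsub] scaleC_diff_right)
  have N0: "N 0 = 0" using hom[of 0 0] X by simp
  \<comment> \<open>Each new increment is \<open>T (n h)\<close> applied to the first one, so
    contractivity bounds all increments by the first.\<close>
  have tele: "N (T (real n * h) z - z) \<le> real n * N (T h z - z)" if h: "0 \<le> h" for h n
  proof (induction n)
    case 0
    then show ?case using z by (simp add: T_def e_def S_0 N0)
  next
    case (Suc n)
    have nh: "0 \<le> real n * h" using h by simp
    have "T (real n * h + h) z - z = T (real n * h) (T h z - z) + (T (real n * h) z - z)"
      using h nh z by (simp add: T_add T_diff T_X)
    then have "N (T (real n * h + h) z - z) \<le> N (T (real n * h) (T h z - z)) + N (T (real n * h) z - z)"
      using h nh z by (simp only: tri T_X X)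
    also have "\<dots> \<le> N (T h z - z) + real n * N (T h z - z)"
      using h nh z by (intro add_mono Suc T_contr X T_X)
    finally show ?case by (simp add: algebra_simps)
  qed
  \<comment> \<open>\<open>R h\<close> bounds the norm of (T h z - z) / h. Its first three terms are
    the errors of the difference quotients of \<open>S\<close> and \<open>e\<close> and of replacing
    \<open>e h\<close> by 1; they vanish as h tends to 0, leaving the defect.\<close>
  define R where "R h = N ((1 / h) *\<^sub>R (S h z - z) - y) + cmod (e h - 1) * N y
      + cmod ((e h - 1) / of_real h + c) * N z + N (y - c *\<^sub>C z)" for h
  have step: "N (T h z - z) \<le> h * R h" if h: "0 < h" for h
  proof -
    let ?q = "(1 / h) *\<^sub>R (S h z - z) - y"
    have Sz: "S h z \<in> X" using h z by (simp add: S_X)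
    have q: "?q \<in> X" using Sz y z by (intro X)
    have "h *\<^sub>R (e h *\<^sub>C ?q + (e h - 1) *\<^sub>C y + ((e h - 1) / of_real h + c) *\<^sub>C z + (y - c *\<^sub>C z))
      = T h z - z"
    proof -
      have "h *\<^sub>R (e h *\<^sub>C ?q) = e h *\<^sub>C S h z - e h *\<^sub>C z - e h *\<^sub>C (h *\<^sub>R y)"
        using h by (simp add: scaleC_diff_right scaleC_scaleR scaleR_diff_right)
      moreover have "h *\<^sub>R (((e h - 1) / of_real h + c) *\<^sub>C z) = e h *\<^sub>C z - z + h *\<^sub>R (c *\<^sub>C z)"
        using h by (simp add: scaleR_scaleC scaleC_scaleC distrib_left scaleC_add_left scaleC_add_right
            scaleC_diff_left)
      ultimately show ?thesis
        by (simp add: T_def scaleR_add_right scaleR_diff_right scaleC_diff_left scaleC_scaleR)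
    qed
    then have "T h z - z = of_real h *\<^sub>C (e h *\<^sub>C ?q + (e h - 1) *\<^sub>C y
        + ((e h - 1) / of_real h + c) *\<^sub>C z + (y - c *\<^sub>C z))"
      unfolding scaleR_scaleC by (rule sym)
    also have "N \<dots> = h * N (e h *\<^sub>C ?q + (e h - 1) *\<^sub>C y
        + ((e h - 1) / of_real h + c) *\<^sub>C z + (y - c *\<^sub>C z))"
      by (subst hom) (use h q y z in \<open>auto intro!: X\<close>)
    also have "\<dots> \<le> h * (N (e h *\<^sub>C ?q) + N ((e h - 1) *\<^sub>C y)
        + N (((e h - 1) / of_real h + c) *\<^sub>C z) + N (y - c *\<^sub>C z))"
      by (rule mult_left_mono, (rule order_trans[OF tri] add_mono order_refl X q y z)+)
        (use h in simp)
    also have "\<dots> = h * R h"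
      using q y z by (simp only: R_def hom e1 mult_1)
    finally show ?thesis .
  qed
  have R_lim: "(R \<longlongrightarrow> N (y - c *\<^sub>C z)) (at_right 0)"
  proof -
    have "((\<lambda>h. e h) \<longlongrightarrow> 1) (at_right 0)"
      using tendsto_exp[OF tendsto_mult[OF tendsto_const tendsto_of_real[OF tendsto_ident_at]],
          of "- c" 0 "{0<..}"] by (simp add: e_def)
    then have "((\<lambda>h. cmod (e h - 1)) \<longlongrightarrow> 0) (at_right 0)"
      by (intro tendsto_norm_zero) (simp add: LIM_zero_iff)
    moreover have "((\<lambda>h. cmod ((e h - 1) / of_real h + c)) \<longlongrightarrow> 0) (at_right 0)"
      using LIM_zero[OF exp_of_real_quotient[of c]] unfolding e_def
      by (intro tendsto_norm_zero) simp
    ultimately have "(R \<longlongrightarrow> 0 + 0 * N y + 0 * N z + N (y - c *\<^sub>C z)) (at_right 0)"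
      unfolding R_def by (intro tendsto_intros lim)
    then show ?thesis by simp
  qed
  have "(\<lambda>n. inverse (real n)) \<longlonglongrightarrow> 0" by (rule lim_inverse_n)
  then have "(\<lambda>n. t / real n) \<longlonglongrightarrow> 0"
    using tendsto_mult_left[of _ 0 _ t] by (simp add: divide_inverse)
  then have "filterlim (\<lambda>n. t / real n) (at_right 0) sequentially"
    unfolding filterlim_at using t by (auto intro!: eventually_sequentiallyI[of 1])
  then have "(\<lambda>n. R (t / real n)) \<longlonglongrightarrow> N (y - c *\<^sub>C z)"
    by (rule filterlim_compose[OF R_lim])
  then have tR: "(\<lambda>n. t * R (t / real n)) \<longlonglongrightarrow> t * N (y - c *\<^sub>C z)"
    by (intro tendsto_intros)
  have "N (T t z - z) \<le> t * N (y - c *\<^sub>C z)"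
  proof (rule LIMSEQ_le_const[OF tR], intro exI[of _ 1] allI impI)
    fix n :: nat assume n: "1 \<le> n"
    have "N (T t z - z) = N (T (real n * (t / real n)) z - z)" using n by simp
    also have "\<dots> \<le> real n * N (T (t / real n) z - z)" using t by (intro tele) simp
    also have "\<dots> \<le> real n * (t / real n * R (t / real n))"
      using t n by (intro mult_left_mono step) auto
    also have "\<dots> = t * R (t / real n)" using n by simp
    finally show "N (T t z - z) \<le> t * R (t / real n)" .
  qed
  moreover have "N z \<le> N (T t z) + N ((-1) *\<^sub>C (T t z - z))"
    using tri[of "T t z" "(-1) *\<^sub>C (T t z - z)"] t z
    by (simp add: X T_X) (simp add: scaleC_minus_left)
  moreover have "N ((-1) *\<^sub>C (T t z - z)) = N (T t z - z)"
    using t z by (subst hom) (auto simp: X T_X)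
  moreover have "N (T t z) = N (S t z)"
    using t z by (simp add: T_def hom S_X e1)
  ultimately show ?thesis by linarith
qed

text \<open>\<open>generator\<close> picks its value by a definite description. Two candidates have
  distance 0 in \<open>N\<close>, so definiteness on \<open>X\<close> is what makes the description
  unique.\<close>

lemma has_generator_value_if_generator:
  assumes gen: "generator X N S z = Some y" and sg: "contraction_semigroup X N S"
    and X: "csubspace X"
    and tri: "\<And>x y. x \<in> X \<Longrightarrow> y \<in> X \<Longrightarrow> N (x + y) \<le> N x + N y"
    and hom: "\<And>a x. x \<in> X \<Longrightarrow> N (a *\<^sub>C x) = cmod a * N x"
    and definite: "\<And>x. x \<in> X \<Longrightarrow> N x = 0 \<Longrightarrow> x = 0"
  shows "has_generator_value X N S z y"
proof -
  note X = csubspaceD[OF X]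
  have ex: "\<exists>y. has_generator_value X N S z y" and y: "y = (THE y. has_generator_value X N S z y)"
    using gen by (auto simp: generator_def split: if_splits)
  \<comment> \<open>Nonnegativity follows from the other two axioms: 0 = N (x - x) \<le> 2 * N
    x.\<close>
  have nonneg: "0 \<le> N x" if "x \<in> X" for x
  proof -
    have "N (x + (-1) *\<^sub>C x) \<le> N x + N ((-1) *\<^sub>C x)" using that by (intro tri X)
    moreover have "N (x + (-1) *\<^sub>C x) = 0"
      using hom[of 0 0] X by (simp add: scaleC_minus_left)
    ultimately show ?thesis using that by (simp add: hom)
  qed
  have "y1 = y2" if 1: "has_generator_value X N S z y1" and 2: "has_generator_value X N S z y2" for y1 y2
  proof -
    have z: "z \<in> X" and ys: "y1 \<in> X" "y2 \<in> X" using 1 2 by (auto simp: has_generator_value_def)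
    let ?q = "\<lambda>t. (1 / t) *\<^sub>R (S t z - z)"
    have "((\<lambda>t. N (?q t - y1) + N (?q t - y2)) \<longlongrightarrow> 0 + 0) (at_right 0)"
      using 1 2 unfolding has_generator_value_def by (intro tendsto_add) auto
    moreover have "\<forall>\<^sub>F t in at_right 0. N (y2 - y1) \<le> N (?q t - y1) + N (?q t - y2)"
      unfolding eventually_at_right_field
    proof (intro exI[of _ 1] conjI allI impI)
      fix t :: real assume "0 < t"
      then have "0 \<le> t" by simp
      then have "S t z \<in> X" using sg z by (auto simp: contraction_semigroup_def)
      then have q: "?q t \<in> X" using z by (intro X)
      note q1 = X(6)[OF q ys(1)] and q2 = X(6)[OF q ys(2)]
      have eq: "y2 - y1 = (?q t - y1) + (-1) *\<^sub>C (?q t - y2)"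
        by (simp add: scaleC_minus_left)
      have "N (y2 - y1) \<le> N (?q t - y1) + N ((-1) *\<^sub>C (?q t - y2))"
        unfolding eq by (rule tri[OF q1 X(3)[OF q2]])
      also have "N ((-1) *\<^sub>C (?q t - y2)) = N (?q t - y2)"
        using hom[OF q2, of "-1"] by simp
      finally show "N (y2 - y1) \<le> N (?q t - y1) + N (?q t - y2)" .
    qed simp
    ultimately have "N (y2 - y1) \<le> 0 + 0" by (intro tendsto_lowerbound) auto
    moreover have "y2 - y1 \<in> X" using ys by (intro X)
    ultimately show ?thesis using definite[of "y2 - y1"] nonneg[of "y2 - y1"] by simp
  qed
  with ex have "\<exists>!y. has_generator_value X N S z y" by blast
  then show ?thesis unfolding y by (rule theI')
qed

section \<open>The inverse of the generator and lower bounds for the decay rate\<close>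

lemma op_inverse_eq_Some:
  assumes "G z = Some y" "\<And>z'. G z' = Some y \<Longrightarrow> z' = z"
  shows "op_inverse G y = Some z"
proof -
  have "(THE x. G x = Some y) = z" by (rule the_equality) (fact assms)+
  moreover have "\<exists>!x. G x = Some y" using assms by blast
  ultimately show ?thesis by (simp add: op_inverse_def)
qed

text \<open>Where \<open>op_inverse G\<close> is undefined, \<open>decay_rate\<close> involves the unspecified value \<open>the None\<close>;
  it still is a supremum of a bounded set.\<close>

lemma decay_rate_ge:
  assumes stable: "semiuniformly_stable N G S" and t: "0 \<le> t"
    and G: "G z = Some y" and inj: "\<And>z'. G z' = Some y \<Longrightarrow> z' = z"
    and y: "y \<in> X" "N y \<le> 1"
  shows "N (S t z) \<le> decay_rate X N G S t"
proof -
  obtain \<psi> where \<psi>: "\<And>t. 0 \<le> t \<Longrightarrow> 0 \<le> \<psi> t"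
    "\<And>z t. z \<in> dom G \<Longrightarrow> 0 \<le> t \<Longrightarrow> N (S t z) \<le> \<psi> t * N (the (G z))"
    using stable unfolding semiuniformly_stable_def by blast
  let ?g = "\<lambda>y. N (S t (the (op_inverse G y)))"
  \<comment> \<open>A supremum of reals dominates its members only if the set is bounded above:
    stability bounds the values where the inverse exists, and everywhere else the value is one fixed
    number.\<close>
  have "?g y' \<le> max (\<psi> t) (N (S t (the None)))" if "N y' \<le> 1" for y'
  proof (cases "\<exists>!x. G x = Some y'")
    case True
    then obtain x where x: "G x = Some y'" "\<And>x'. G x' = Some y' \<Longrightarrow> x' = x" by blast
    have inv: "op_inverse G y' = Some x" by (rule op_inverse_eq_Some) (fact x)+
    have "N (S t x) \<le> \<psi> t * N y'" using \<psi>(2)[of x t] x(1) t by (simp add: domI)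
    also have "\<dots> \<le> \<psi> t * 1" by (rule mult_left_mono[OF that \<psi>(1)[OF t]])
    finally show ?thesis by (simp add: inv)
  next
    case False
    then have "op_inverse G y' = None" by (simp only: op_inverse_def if_False)
    then show ?thesis by simp
  qed
  then have "bdd_above (?g ` {z \<in> X. N z \<le> 1})" by (auto intro!: bdd_aboveI2)
  then have "?g y \<le> decay_rate X N G S t"
    unfolding decay_rate_def operator_norm_def by (rule cSUP_upper[rotated]) (use y in auto)
  moreover have "op_inverse G y = Some z"
    by (rule op_inverse_eq_Some) (fact G inj)+
  ultimately show ?thesis by simp
qed

section \<open>The damped wave operator\<close>

locale damped_wave = pvm E
  for E :: "real set \<Rightarrow> 'h::complex_hilbert \<Rightarrow> 'h" +
  fixes A :: "'h \<rightharpoonup> 'h" and f :: "real \<Rightarrow> real"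
  assumes A_eq: "A = spectral_integral E (\<lambda>s. s)"
    and positive: "strictly_positive A"
    and f_continuous: "continuous_on (real_spectrum A) f"
begin

abbreviation rt :: "real \<Rightarrow> real" where
  "rt \<equiv> \<lambda>s. if s \<in> real_spectrum A then s powr (1 / 2) else 0"

abbreviation ft :: "real \<Rightarrow> real" where
  "ft \<equiv> \<lambda>s. if s \<in> real_spectrum A then f s else 0"

text \<open>\<open>Q\<close> is the square root of A, and \<open>F\<close> is
  \<open>f(A)\<close>.\<close>

abbreviation "Q \<equiv> spectral_integral E rt"
abbreviation "F \<equiv> spectral_integral E ft"
abbreviation "X \<equiv> phase_space A E"
abbreviation "N \<equiv> phase_norm A E"
abbreviation "G \<equiv> damped_operator A E f"

lemma linear_A: "linear_operator A"
  unfolding A_eq by (rule linear_operator_spectral_integral) simp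

lemma spectrum_borel [measurable]: "real_spectrum A \<in> sets borel"
  using closed_real_spectrum[OF linear_A] by simp

lemma rt_measurable [measurable]: "rt \<in> borel_measurable borel"
  by measurable

text \<open>f is continuous only on the spectrum and arbitrary elsewhere, so measurability concerns
  the cut-off function and rests on the spectrum being Borel.\<close>

lemma ft_measurable [measurable]: "ft \<in> borel_measurable borel"
  by (intro borel_measurable_continuous_on_if f_continuous) auto

lemma phase_space_eq: "X = dom Q \<times> UNIV"
  by (simp add: phase_space_def H_space_def op_powr_def functional_calculus_def)

text \<open>Writing \<open>N\<close> as the product norm of (Q u, v) lets it inherit the triangle
  inequality and homogeneity from the Hilbert space of pairs.\<close>

lemma phase_norm_eq: "N z = norm (the (Q (fst z)), snd z)"
  by (simp add: phase_norm_def H_norm_def op_powr_def functional_calculus_def norm_prod_def)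

lemma G_eq: "G (u, v) = (if u \<in> dom Q \<and> v \<in> dom Q \<and> (\<exists>h. represents_sum A F u v h)
    then Some (v, - (THE h. represents_sum A F u v h)) else None)"
  by (simp add: damped_operator_def phase_space_def H_space_def op_powr_def functional_calculus_def)

lemma linear_Q: "linear_operator Q"
  by (rule linear_operator_spectral_integral) measurable

lemma csubspace_phase_space: "csubspace X"
  using linear_Q
  by (simp add: linear_operator_def csubspace_def phase_space_eq scaleC_prod_def zero_prod_def mem_Times_iff)

lemma phase_norm_triangle: "z \<in> X \<Longrightarrow> w \<in> X \<Longrightarrow> N (z + w) \<le> N z + N w"
  using norm_triangle_ineq[of "(the (Q (fst z)), snd z)" "(the (Q (fst w)), snd w)"]
  by (simp add: phase_norm_eq phase_space_eq mem_Times_iff op_linear(1)[OF linear_Q])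

lemma phase_norm_scale: "z \<in> X \<Longrightarrow> N (a *\<^sub>C z) = cmod a * N z"
  using norm_scaleC[of a "(the (Q (fst z)), snd z)"]
  by (simp add: phase_norm_eq phase_space_eq mem_Times_iff op_linear(2)[OF linear_Q] scaleC_prod_def)

text \<open>A nonzero vector in the range of \<open>E (ball s \<epsilon>)\<close> satisfies A x = s
  x up to \<epsilon> * norm x. For small \<epsilon> this contradicts the resolvent bound if s lies
  off the spectrum, and strict positivity if s \<le> 0.\<close>

lemma locally_null_outside:
  assumes s: "s \<le> 0 \<or> s \<notin> real_spectrum A"
  shows "\<exists>U. open U \<and> s \<in> U \<and> (\<forall>x. E U x = 0)"
proof -
  have near: "norm (the (A x) - s *\<^sub>R x) \<le> \<epsilon> * norm x" "x \<in> dom A"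
    if "E (ball s \<epsilon>) x = x" "0 < \<epsilon>" for \<epsilon> x
    using spectral_integral_near_const[OF _ _ that(1), of "\<lambda>s. s" s \<epsilon>] that(2)
    by (auto simp: A_eq dist_real_def abs_minus_commute)
  have "\<exists>\<epsilon>>0. \<forall>x. E (ball s \<epsilon>) x = x \<longrightarrow> x = 0"
  proof (cases "s \<in> real_spectrum A")
    case False
    then have "complex_of_real s \<in> resolvent_set A" by (simp add: real_spectrum_def spectrum_def)
    then obtain K where K: "\<And>x. x \<in> dom A \<Longrightarrow> norm x \<le> K * norm (the (A x) - s *\<^sub>R x)"
      by (auto simp: resolvent_set_def scaleR_scaleC)
    define \<epsilon> where "\<epsilon> = 1 / (\<bar>K\<bar> + 1)"
    have \<epsilon>: "0 < \<epsilon>" "\<bar>K\<bar> * \<epsilon> < 1" by (simp_all add: \<epsilon>_def field_simps)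
    have "x = 0" if x: "E (ball s \<epsilon>) x = x" for x
    proof (rule ccontr)
      assume "x \<noteq> 0"
      have "norm x \<le> \<bar>K\<bar> * norm (the (A x) - s *\<^sub>R x)"
        using K[OF near(2)[OF x \<epsilon>(1)]] by (rule order_trans) (intro mult_right_mono, auto)
      also have "\<dots> \<le> \<bar>K\<bar> * (\<epsilon> * norm x)" by (intro mult_left_mono near x \<epsilon>) simp
      also have "\<dots> = (\<bar>K\<bar> * \<epsilon>) * norm x" by simp
      also have "\<dots> < 1 * norm x" using \<epsilon> \<open>x \<noteq> 0\<close> by (intro mult_strict_right_mono) auto
      finally show False by simp
    qed
    then show ?thesis using \<epsilon> by blast
  next
    case True
    with s have s: "s \<le> 0" by simp
    obtain c where c: "0 < c" "\<And>x. x \<in> dom A \<Longrightarrow> c * (norm x)\<^sup>2 \<le> Re (cinner (the (A x)) x)"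
      using positive unfolding strictly_positive_def by blast
    \<comment> \<open>Radius c / 2 leaves the quadratic form at most c / 2 times the squared norm,
      while positivity demands c times it.\<close>
    have "x = 0" if x: "E (ball s (c / 2)) x = x" for x
    proof -
      have x': "norm (the (A x) - s *\<^sub>R x) \<le> c / 2 * norm x" "x \<in> dom A"
        using near[OF x] c by auto
      have "c * (norm x)\<^sup>2 \<le> Re (cinner (the (A x)) x)" using c x' by simp
      also have "\<dots> = Re (cinner (the (A x) - s *\<^sub>R x) x) + s * (norm x)\<^sup>2"
        by (simp add: cinner_diff_left cinner_scaleR_left cinner_self)
      also have "\<dots> \<le> norm (the (A x) - s *\<^sub>R x) * norm x + 0"
        using s by (intro add_mono Re_cinner_le) (simp add: mult_nonpos_nonneg)
      also have "\<dots> \<le> (c / 2 * norm x) * norm x"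
        using mult_right_mono[OF x'(1), of "norm x"] by simp
      finally have "c / 2 * (norm x)\<^sup>2 \<le> 0" by (simp add: power2_eq_square)
      then show ?thesis using c by (simp add: mult_le_0_iff)
    qed
    then show ?thesis using c by (intro exI[of _ "c / 2"]) auto
  qed
  then obtain \<epsilon> where "0 < \<epsilon>" "\<And>x. E (ball s \<epsilon>) x = x \<Longrightarrow> x = 0" by blast
  then show ?thesis by (intro exI[of _ "ball s \<epsilon>"]) (auto simp: E_idem)
qed

text \<open>A vector killed by \<open>Q\<close> has its measure concentrated where \<open>rt\<close>
  vanishes, hence off the spectrum or at 0, and \<open>E\<close> is null there.\<close>

lemma Q_definite:
  assumes u: "u \<in> dom Q" and Qu: "the (Q u) = 0"
  shows "u = 0"
proof -
  obtain W where W: "open W" "{s. s \<le> 0 \<or> s \<notin> real_spectrum A} \<subseteq> W" "\<And>x. E W x = 0"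
    by (rule E_null_if_locally_null[of "{s. s \<le> 0 \<or> s \<notin> real_spectrum A}"])
      (use locally_null_outside in auto)
  have int: "integrable (M u) (\<lambda>s. (rt s)\<^sup>2)" using u by (simp add: dom_spectral_integral)
  have "(\<integral>s. (rt s)\<^sup>2 \<partial>M u) = 0"
    using norm_spectral_integral_sq[OF rt_measurable u] Qu by simp
  then have "AE s in M u. (rt s)\<^sup>2 = 0"
    using integral_nonneg_eq_0_iff_AE[OF int] by simp
  moreover have "AE s in M u. s \<notin> W"
    using W(1,3) by (intro AE_not_in) (simp add: null_sets_def emeasure_M)
  ultimately have "AE s in M u. False"
    by eventually_elim (use W(2) in \<open>auto split: if_splits\<close>)
  then have "emeasure (M u) UNIV = 0"
    using AE_iff_measurable[of UNIV "M u" "\<lambda>_. False"] by simp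
  then show ?thesis by (simp add: emeasure_M)
qed

lemma phase_norm_definite: "z \<in> X \<Longrightarrow> N z = 0 \<Longrightarrow> z = 0"
  using Q_definite[of "fst z"]
  by (simp add: phase_norm_eq phase_space_eq prod_eq_iff mem_Times_iff)

text \<open>Formulated with the support of \<open>E\<close> because nonzero vectors in the ranges of
  small balls are what the construction needs. If \<open>E\<close> were locally null beyond n, it
  would live on a bounded interval and A would be bounded.\<close>

lemma spectral_support_unbounded:
  assumes "unbounded_operator A"
  shows "\<exists>s>n. \<forall>U. open U \<longrightarrow> s \<in> U \<longrightarrow> (\<exists>x. E U x \<noteq> 0)"
proof (rule ccontr)
  assume neg: "\<not> ?thesis"
  \<comment> \<open>Including the nonpositive reals confines the complement of \<open>W\<close> on
    both sides; n itself may be negative, whence \<open>max n 0\<close> below.\<close>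
  define V where "V = {s. s \<le> 0 \<or> s > n}"
  have null: "\<exists>U. open U \<and> s \<in> U \<and> (\<forall>x. E U x = 0)" if "s \<in> V" for s
  proof (cases "s > n")
    case True
    then have "\<not> (\<forall>U. open U \<longrightarrow> s \<in> U \<longrightarrow> (\<exists>x. E U x \<noteq> 0))" using neg by meson
    then show ?thesis by meson
  next
    case False
    then show ?thesis using that by (intro locally_null_outside) (simp add: V_def)
  qed
  obtain W where W: "open W" "V \<subseteq> W" "\<And>x. E W x = 0"
    by (rule E_null_if_locally_null[of V]) (use null in auto)
  have "norm (the (A x)) \<le> max n 0 * norm x" for x
  proof -
    have "E (W \<union> - W) x = E W x + E (- W) x" using W(1) by (intro E_Un) auto
    then have x: "E (- W) x = x" by (simp add: W(3))
    have "\<bar>s\<bar> \<le> max n 0" if "s \<in> - W" for s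
    proof -
      have "s \<notin> V" using that W(2) by blast
      then show ?thesis by (auto simp: V_def)
    qed
    then show ?thesis unfolding A_eq
      by (intro spectral_integral_bounded(2)[OF _ _ x]) (use W(1) in auto)
  qed
  then show False using assms unfolding unbounded_operator_def by blast
qed

section \<open>A common core, well-definedness and injectivity of the damped operator\<close>

lemma core_dom: "E {- real n..<real n} w \<in> dom A \<inter> dom F"
proof -
  let ?B = "{- real n..<real n}"
  have E: "E ?B (E ?B w) = E ?B w" by (simp add: E_idem)
  have "compact (real_spectrum A \<inter> {- real n..real n})"
    using closed_real_spectrum[OF linear_A] by (intro closed_Int_compact) auto
  then have "bounded (f ` (real_spectrum A \<inter> {- real n..real n}))"
    by (intro compact_imp_bounded compact_continuous_image continuous_on_subset[OF f_continuous]) auto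
  then obtain K where "\<forall>y \<in> f ` (real_spectrum A \<inter> {- real n..real n}). norm y \<le> K"
    unfolding bounded_iff ..
  then have K: "\<bar>f s\<bar> \<le> K" if "s \<in> real_spectrum A \<inter> {- real n..real n}" for s
    using that by simp
  \<comment> \<open>The maximum covers the value 0 off the spectrum; \<open>K\<close> may be
    negative if the compact piece of the spectrum is empty.\<close>
  have "\<bar>ft s\<bar> \<le> max K 0" if "s \<in> ?B" for s
    using K[of s] that by (auto simp: le_max_iff_disj)
  then have "E ?B w \<in> dom F"
    by (intro spectral_integral_bounded(1)[OF ft_measurable _ E, of "max K 0"]) auto
  moreover have "E ?B w \<in> dom A" unfolding A_eq
    by (rule spectral_integral_bounded(1)[OF _ _ E, of _ "real n"]) auto
  ultimately show ?thesis by simp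
qed

text \<open>\<open>represents_sum\<close> tests only against this intersection, so its density is
  what determines the represented vector.\<close>

lemma core_dense: "closure (dom A \<inter> dom F) = UNIV"
proof -
  have "x \<in> closure (dom A \<inter> dom F)" for x
    unfolding closure_sequential
    by (intro exI[of _ "\<lambda>n. E {- real n..<real n} x"] conjI allI core_dom E_interval_tendsto)
  then show ?thesis by blast
qed

lemma represents_sum_unique:
  assumes "represents_sum A F u v h" "represents_sum A F u v h'"
  shows "h = h'"
proof -
  have "h - h' = 0"
    by (rule cinner_eq_0_dense[OF _ core_dense])
      (use assms in \<open>auto simp: represents_sum_def cinner_diff_right\<close>)
  then show ?thesis by simp
qed

lemma G_SomeD:
  assumes "G (u, v) = Some (v', h)"
  shows "v' = v" "represents_sum A F u v (- h)"
proof -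
  show "v' = v" using assms by (auto simp: G_eq split: if_splits)
  from assms obtain h' where h': "represents_sum A F u v h'" "- h = (THE h. represents_sum A F u v h)"
    by (auto simp: G_eq split: if_splits)
  have "(THE h. represents_sum A F u v h) = h'"
    by (rule the_equality) (use h' represents_sum_unique in blast)+
  then show "represents_sum A F u v (- h)" using h' by simp
qed

text \<open>Needed to evaluate \<open>op_inverse\<close> in the decay rate. Equal values force equal
  second components, so the difference \<open>d\<close> of the first components is orthogonal to the
  image of the core under A. Testing with truncations of \<open>d\<close> itself and using
  positivity kills them all.\<close>

lemma G_injective:
  assumes "G z = Some y" "G z' = Some y"
  shows "z = z'"
proof -
  obtain u v u' v' w h where eq: "z = (u, v)" "z' = (u', v')" "y = (w, h)" by (metis prod.exhaust)
  note D = G_SomeD[OF assms(1)[unfolded eq]] G_SomeD[OF assms(2)[unfolded eq]]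
  define d where "d = u - u'"
  have ortho: "cinner (the (A w)) d = 0" if "w \<in> dom A \<inter> dom F" for w
  proof -
    have "cinner (the (A w)) u + cinner (the (F w)) v = cinner w (- h)"
      "cinner (the (A w)) u' + cinner (the (F w)) v' = cinner w (- h)"
      using D(2,4) that unfolding represents_sum_def by simp_all
    moreover have "v = v'" using D(1,3) by simp
    ultimately have "cinner (the (A w)) u + cinner (the (F w)) v = cinner (the (A w)) u' + cinner (the (F w)) v"
      by simp
    then have "cinner (the (A w)) u = cinner (the (A w)) u'" by simp
    then show ?thesis by (simp add: d_def cinner_diff_right)
  qed
  have "E {- real n..<real n} d = 0" for n
  proof -
    let ?B = "{- real n..<real n}"
    let ?x = "E ?B d"
    have x: "?x \<in> dom A \<inter> dom F" "E ?B ?x = ?x" by (rule core_dom) (simp add: E_idem)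
    \<comment> \<open>A maps the truncation into the range of \<open>E ?B\<close>, so the second
      argument \<open>d\<close> may be replaced by its truncation.\<close>
    have "the (A ?x) = E ?B (the (A ?x))"
      using spectral_integral_E[of "\<lambda>s. s" ?B ?x] x unfolding A_eq by simp
    then have "cinner (the (A ?x)) ?x = cinner (the (A ?x)) d"
      using E_sym[of ?B "the (A ?x)" d] by simp
    then have 0: "cinner (the (A ?x)) ?x = 0" using ortho[OF x(1)] by simp
    obtain c where c: "0 < c" "\<And>x. x \<in> dom A \<Longrightarrow> c * (norm x)\<^sup>2 \<le> Re (cinner (the (A x)) x)"
      using positive unfolding strictly_positive_def by blast
    from c(2)[of ?x] x 0 have "c * (norm ?x)\<^sup>2 \<le> 0" by simp
    then show ?thesis using c(1) by (simp add: mult_le_0_iff)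
  qed
  then have "d = 0" using E_interval_tendsto[of d] by (simp add: LIMSEQ_const_iff)
  then show ?thesis using eq D by (simp add: d_def)
qed

text \<open>\<open>x\<close> lies in the domains of both A and \<open>F\<close>, so the duality sum
  is the ordinary one. The first component of the defect vanishes, and l * l = - s0 turns the second
  into \<open>(A - s0) x + l F x\<close> up to sign. The factor 2 in the upper bound comes from (s0
  + 1) + s0 \<le> 4 * s0.\<close>

lemma quasi_eigenvector:
  assumes s0: "2 \<le> s0" and \<delta>: "0 < \<delta>" "\<delta> \<le> 1" and x: "E (ball s0 \<delta>) x = x"
    and \<kappa>: "\<And>s. s \<in> real_spectrum A \<Longrightarrow> s \<in> ball s0 \<delta> \<Longrightarrow> \<bar>f s\<bar> \<le> \<kappa>" "0 \<le> \<kappa>"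
  defines "l \<equiv> \<i> * complex_of_real (sqrt s0)"
  obtains y where "G (x, l *\<^sub>C x) = Some y" "y \<in> X" "(x, l *\<^sub>C x) \<in> X"
    "N (y - l *\<^sub>C (x, l *\<^sub>C x)) \<le> (\<delta> + sqrt s0 * \<kappa>) * norm x"
    "sqrt s0 * norm x \<le> N (x, l *\<^sub>C x)" "N (x, l *\<^sub>C x) \<le> 2 * sqrt s0 * norm x"
proof -
  have l: "cmod l = sqrt s0" "l * l = - complex_of_real s0"
    using s0 by (simp_all add: l_def norm_mult algebra_simps flip: of_real_mult)
  have Ax: "x \<in> dom A" "norm (the (A x) - s0 *\<^sub>R x) \<le> \<delta> * norm x"
    using spectral_integral_near_const[OF _ _ x, of "\<lambda>s. s" s0 \<delta>] \<delta>
    by (auto simp: A_eq dist_real_def abs_minus_commute)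
  have Fx: "x \<in> dom F" "norm (the (F x)) \<le> \<kappa> * norm x"
    using spectral_integral_bounded[OF ft_measurable _ x, of \<kappa>] \<kappa> by auto
  have rt: "\<bar>rt s\<bar> \<le> sqrt (s0 + 1)" if "s \<in> ball s0 \<delta>" for s
  proof -
    have "\<bar>s0 - s\<bar> < 1" using that \<delta> by (simp add: dist_real_def)
    then have "0 \<le> s" "s \<le> s0 + 1" using s0 by linarith+
    then show ?thesis using s0 by (auto simp: powr_half_sqrt)
  qed
  have Qx: "x \<in> dom Q" "norm (the (Q x)) \<le> sqrt (s0 + 1) * norm x"
    using spectral_integral_bounded[OF rt_measurable _ x rt] s0 by auto
  have Qlx: "l *\<^sub>C x \<in> dom Q" using linear_Q Qx by (simp add: linear_operator_def csubspace_def)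
  define h where "h = the (A x) + l *\<^sub>C the (F x)"
  have rep: "represents_sum A F x (l *\<^sub>C x) h"
    unfolding represents_sum_def
  proof
    fix w assume w: "w \<in> dom A \<inter> dom F"
    have "cinner (the (A w)) x = cinner w (the (A x))"
      using w Ax(1) unfolding A_eq by (intro spectral_integral_sym) auto
    moreover have "cinner (the (F w)) (l *\<^sub>C x) = cinner w (l *\<^sub>C the (F x))"
      using spectral_integral_sym[OF ft_measurable, of w x] w Fx(1)
      by (simp add: cinner_scaleC_right)
    ultimately show "cinner (the (A w)) x + cinner (the (F w)) (l *\<^sub>C x) = cinner w h"
      by (simp add: h_def cinner_add_right)
  qed
  then have "(THE h. represents_sum A F x (l *\<^sub>C x) h) = h"
    by (rule the_equality) (use rep represents_sum_unique in blast)
  then have "G (x, l *\<^sub>C x) = Some (l *\<^sub>C x, - h)"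
    using rep Qx Qlx by (auto simp: G_eq)
  moreover have "(l *\<^sub>C x, - h) \<in> X" "(x, l *\<^sub>C x) \<in> X" using Qx Qlx by (simp_all add: phase_space_eq)
  moreover have "N ((l *\<^sub>C x, - h) - l *\<^sub>C (x, l *\<^sub>C x)) \<le> (\<delta> + sqrt s0 * \<kappa>) * norm x"
  proof -
    have "- h - l *\<^sub>C (l *\<^sub>C x) = - ((the (A x) - s0 *\<^sub>R x) + l *\<^sub>C the (F x))"
      by (simp add: h_def scaleC_scaleC l scaleC_minus_left scaleR_scaleC)
    then have "N ((l *\<^sub>C x, - h) - l *\<^sub>C (x, l *\<^sub>C x)) = norm ((the (A x) - s0 *\<^sub>R x) + l *\<^sub>C the (F x))"
      by (simp add: phase_norm_eq scaleC_prod_def op_linear(3)[OF linear_Q] norm_Pair del: minus_add_distrib minus_diff_eq)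
    also have "\<dots> \<le> norm (the (A x) - s0 *\<^sub>R x) + norm (l *\<^sub>C the (F x))" by (rule norm_triangle_ineq)
    also have "\<dots> \<le> \<delta> * norm x + sqrt s0 * (\<kappa> * norm x)"
      unfolding norm_scaleC l(1) using s0 by (intro add_mono mult_left_mono Ax Fx) auto
    finally show ?thesis by (simp add: algebra_simps)
  qed
  moreover have "sqrt s0 * norm x \<le> N (x, l *\<^sub>C x)"
    using norm_snd_le[of "l *\<^sub>C x" "the (Q x)"] by (simp add: phase_norm_eq norm_scaleC l)
  moreover have "N (x, l *\<^sub>C x) \<le> 2 * sqrt s0 * norm x"
  proof -
    have "(norm (the (Q x)))\<^sup>2 \<le> (sqrt (s0 + 1) * norm x)\<^sup>2" using Qx(2) by (intro power_mono) auto
    then have "(norm (the (Q x)))\<^sup>2 + (sqrt s0 * norm x)\<^sup>2 \<le> (s0 + 1 + s0) * (norm x)\<^sup>2"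
      using s0 by (simp add: power_mult_distrib algebra_simps)
    also have "\<dots> \<le> (4 * s0) * (norm x)\<^sup>2" using s0 by (intro mult_right_mono) auto
    also have "\<dots> = (2 * sqrt s0 * norm x)\<^sup>2" using s0 by (simp add: power_mult_distrib)
    finally show ?thesis
      using s0 by (simp add: phase_norm_eq norm_Pair norm_scaleC l real_sqrt_le_iff real_le_lsqrt)
  qed
  ultimately show thesis by (rule that)
qed

text \<open>In \<open>K\<close>, the summand 1 pays for the error from A, and C * 2 powr \<beta> for
  the damping, whose bound is taken at s0 / 2 instead of s0.\<close>

lemma decay_rate_at_spectral_point:
  assumes sg: "contraction_semigroup X N S" and gen: "generator X N S = G"
    and stable: "semiuniformly_stable N G S" and f_nonneg: "\<forall>s\<in>real_spectrum A. 0 \<le> f s"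
    and \<beta>: "0 < \<beta>" and C: "\<And>s. s \<in> real_spectrum A \<Longrightarrow> s powr \<beta> * f s \<le> C" "0 \<le> C"
    and s0: "2 \<le> s0" and supp: "\<And>U. open U \<Longrightarrow> s0 \<in> U \<Longrightarrow> \<exists>x. E U x \<noteq> 0"
  defines "K \<equiv> 1 + C * 2 powr \<beta>"
  shows "s0 powr (- 1 / 2) / (2 * (2 + K)) \<le> decay_rate X N G S (s0 powr \<beta> / (2 * K))"
proof -
  have K: "1 \<le> K" using C by (simp add: K_def)
  have sq: "sqrt s0 = s0 powr (1 / 2)" using s0 by (simp add: powr_half_sqrt)
  \<comment> \<open>The bound 1 keeps the ball above s0 / 2; the other bound is sqrt s0 * s0 powr -
    \<beta>, the scale of the damping error.\<close>
  define \<delta> where "\<delta> = min 1 (s0 powr (1 / 2 - \<beta>))"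
  define \<kappa> where "\<kappa> = C * (s0 / 2) powr - \<beta>"
  have \<delta>: "0 < \<delta>" "\<delta> \<le> 1" using s0 by (auto simp: \<delta>_def)
  have \<kappa>: "\<bar>f s\<bar> \<le> \<kappa>" if "s \<in> real_spectrum A" "s \<in> ball s0 \<delta>" for s
  proof -
    have "\<bar>s0 - s\<bar> < 1" using that \<delta> by (simp add: dist_real_def)
    then have s: "s0 / 2 \<le> s" "0 < s" using s0 by linarith+
    have "f s = (s powr \<beta> * f s) * s powr - \<beta>" using s by (simp add: powr_minus)
    also have "\<dots> \<le> C * (s0 / 2) powr - \<beta>"
      using s s0 \<beta> C f_nonneg that by (intro mult_mono C powr_mono2') auto
    finally show ?thesis using f_nonneg that by (simp add: \<kappa>_def)
  qed
  obtain x0 where x0: "E (ball s0 \<delta>) x0 \<noteq> 0" using supp[of "ball s0 \<delta>"] \<delta> by auto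
  \<comment> \<open>\<open>N y\<close> will be at most (K + 2) * s0 * norm x: K from the defect and
    2 from l z. Scaling \<open>x\<close> to norm 1 / r puts \<open>y\<close> into the unit ball of
    the supremum.\<close>
  define r where "r = (2 + K) * s0"
  have r: "0 < r" using K s0 by (simp add: r_def)
  define x where "x = (1 / (r * norm (E (ball s0 \<delta>) x0))) *\<^sub>R E (ball s0 \<delta>) x0"
  have nx: "norm x = 1 / r" using x0 r by (simp add: x_def)
  have x: "E (ball s0 \<delta>) x = x" by (simp add: x_def linear_scale[OF linear_E] E_idem)
  define l where "l = \<i> * complex_of_real (sqrt s0)"
  have "0 \<le> \<kappa>" using C by (simp add: \<kappa>_def)
  from quasi_eigenvector[OF s0 \<delta> x \<kappa> this, folded l_def]
  obtain y where G: "G (x, l *\<^sub>C x) = Some y" and X: "y \<in> X" "(x, l *\<^sub>C x) \<in> X"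
    and err: "N (y - l *\<^sub>C (x, l *\<^sub>C x)) \<le> (\<delta> + sqrt s0 * \<kappa>) * norm x"
    and N: "sqrt s0 * norm x \<le> N (x, l *\<^sub>C x)" "N (x, l *\<^sub>C x) \<le> 2 * sqrt s0 * norm x"
    by blast
  define z where "z = (x, l *\<^sub>C x)"
  note [folded z_def] = G X err N
  have "s0 powr (1 / 2 - \<beta>) = sqrt s0 * s0 powr - \<beta>"
    by (simp add: sq powr_add[symmetric])
  then have "\<delta> \<le> sqrt s0 * s0 powr - \<beta>" by (simp add: \<delta>_def)
  moreover have "\<kappa> = C * 2 powr \<beta> * s0 powr - \<beta>"
    using s0 by (simp add: \<kappa>_def powr_divide powr_minus field_simps)
  ultimately have "\<delta> + sqrt s0 * \<kappa> \<le> K * (sqrt s0 * s0 powr - \<beta>)"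
    by (simp add: K_def algebra_simps)
  then have "(\<delta> + sqrt s0 * \<kappa>) * norm x \<le> K * (sqrt s0 * s0 powr - \<beta>) * norm x"
    by (rule mult_right_mono) simp
  then have err': "N (y - l *\<^sub>C z) \<le> K * (sqrt s0 * s0 powr - \<beta>) * norm x"
    using err by (simp add: z_def)
  \<comment> \<open>At this time, t times the defect bound is sqrt s0 * norm x / 2, half of the
    lower bound for \<open>N z\<close>.\<close>
  define t where "t = s0 powr \<beta> / (2 * K)"
  have t: "0 < t" using K s0 by (simp add: t_def)
  have "sqrt s0 \<le> s0" using s0 by (intro real_le_lsqrt) (auto simp: power2_eq_square)
  have "s0 powr - \<beta> \<le> 1" using s0 \<beta> by (simp add: powr_minus inverse_le_1_iff ge_one_powr_ge_zero)
  have "N y \<le> 1"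
  proof -
    have "y = (y - l *\<^sub>C z) + l *\<^sub>C z" by simp
    then have "N y \<le> N (y - l *\<^sub>C z) + N (l *\<^sub>C z)"
      using X csubspaceD[OF csubspace_phase_space] unfolding z_def by (metis phase_norm_triangle)
    also have "N (l *\<^sub>C z) = sqrt s0 * N z"
      using X s0 by (simp add: phase_norm_scale z_def l_def norm_mult)
    also have "N (y - l *\<^sub>C z) + sqrt s0 * N z \<le> K * (s0 * 1) * norm x + sqrt s0 * (2 * sqrt s0 * norm x)"
    proof (intro add_mono mult_left_mono)
      have "K * (sqrt s0 * s0 powr - \<beta>) * norm x \<le> K * (s0 * 1) * norm x"
        by (intro mult_right_mono mult_left_mono mult_mono) (use K s0 \<open>sqrt s0 \<le> s0\<close> \<open>s0 powr - \<beta> \<le> 1\<close> in auto)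
      with err' show "N (y - l *\<^sub>C z) \<le> K * (s0 * 1) * norm x" by (rule order_trans)
      show "N z \<le> 2 * sqrt s0 * norm x" using N by (simp add: z_def)
    qed (use s0 in simp)
    also have "\<dots> = r * norm x" using s0 by (simp add: r_def algebra_simps)
    also have "\<dots> = 1" using nx r by simp
    finally show ?thesis .
  qed
  have "sqrt s0 * norm x / 2 \<le> N (S t z)"
  proof -
    have "has_generator_value X N S z y"
      using G by (intro has_generator_value_if_generator[OF _ sg csubspace_phase_space
          phase_norm_triangle phase_norm_scale phase_norm_definite]) (simp_all add: gen z_def)
    then have "N z - t * N (y - l *\<^sub>C z) \<le> N (S t z)"
      using t by (intro semigroup_quasi_eigenvector[OF sg csubspace_phase_space
          phase_norm_triangle phase_norm_scale]) (simp_all add: l_def)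
    moreover have "t * N (y - l *\<^sub>C z) \<le> t * (K * (sqrt s0 * s0 powr - \<beta>) * norm x)"
      using t by (intro mult_left_mono err') simp
    moreover have "t * (K * (sqrt s0 * s0 powr - \<beta>) * norm x) = sqrt s0 * norm x / 2"
      using K s0 by (simp add: t_def powr_minus)
    ultimately show ?thesis using N by (simp add: z_def)
  qed
  also have "N (S t z) \<le> decay_rate X N G S t"
    using G X \<open>N y \<le> 1\<close> t
    by (intro decay_rate_ge[OF stable, where y = y] G_injective[where y = y]) (simp_all add: z_def)
  also have "sqrt s0 * norm x / 2 = s0 powr (- 1 / 2) / (2 * (2 + K))"
  proof -
    have "s0 powr (- 1 / 2) = sqrt s0 / s0"
      using s0 powr_diff[of s0 "1 / 2" 1] by (simp add: sq)
    moreover have "sqrt s0 * norm x / 2 = sqrt s0 / s0 / (2 * (2 + K))"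
      using s0 K by (simp add: nx r_def)
    ultimately show ?thesis by (simp only:)
  qed
  finally show ?thesis by (simp add: t_def)
qed

end

theorem theorem12p2:
  fixes A :: "'h::complex_hilbert \<rightharpoonup> 'h"
    and E :: "real set \<Rightarrow> 'h \<Rightarrow> 'h"
    and f :: "real \<Rightarrow> real"
    and S :: "real \<Rightarrow> 'h \<times> 'h \<Rightarrow> 'h \<times> 'h"
    and \<beta> :: real
  assumes separable: "separable_space (euclidean :: 'h topology)"
    and selfadjoint: "selfadjoint A"
    and positive: "strictly_positive A"
    and spectral_measure: "is_spectral_measure A E"
    and f_continuous: "continuous_on (real_spectrum A) f"
    and f_nonneg: "\<forall>s\<in>real_spectrum A. 0 \<le> f s"
    and semigroup: "contraction_semigroup (phase_space A E) (phase_norm A E) S"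
    and generated: "generator (phase_space A E) (phase_norm A E) S = damped_operator A E f"
    and stable: "semiuniformly_stable (phase_norm A E) (damped_operator A E f) S"
    and unbounded: "unbounded_operator A"
    and beta_pos: "0 < \<beta>"
    and sup_finite: "bdd_above ((\<lambda>s. s powr \<beta> * f s) ` real_spectrum A)"
  shows "0 < Limsup at_top (\<lambda>t. ereal (t powr (1 / (2 * \<beta>)) *
           decay_rate (phase_space A E) (phase_norm A E) (damped_operator A E f) S t))"
proof -
  interpret damped_wave E A f
  proof
    show "projection_valued_measure E" "A = spectral_integral E (\<lambda>s. s)"
      using spectral_measure unfolding is_spectral_measure_def by blast+
  qed (fact positive f_continuous)+
  obtain C0 where C0: "\<And>s. s \<in> real_spectrum A \<Longrightarrow> s powr \<beta> * f s \<le> C0"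
    using sup_finite by (auto simp: bdd_above_def)
  \<comment> \<open>A nonnegative bound guarantees K \<ge> 1.\<close>
  define C where "C = max C0 0"
  have C: "0 \<le> C" "\<And>s. s \<in> real_spectrum A \<Longrightarrow> s powr \<beta> * f s \<le> C"
    using C0 by (auto simp: C_def le_max_iff_disj)
  define K where "K = 1 + C * 2 powr \<beta>"
  have K: "1 \<le> K" using C by (simp add: K_def)
  let ?g = "\<lambda>t. t powr (1 / (2 * \<beta>)) * decay_rate X N G S t"
  \<comment> \<open>At t = s0 powr \<beta> / (2 * K) the weight equals s0 powr (1/2) times the first
    factor here; the power of s0 cancels against that in the lower bound for the decay rate.\<close>
  define c where "c = (2 * K) powr - (1 / (2 * \<beta>)) / (2 * (2 + K))"
  have c: "0 < c" using K by (simp add: c_def)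
  have large: "\<exists>t\<ge>T. c \<le> ?g t" for T
  proof -
    \<comment> \<open>The second bound forces the resulting time t to be at least |T|.\<close>
    obtain s0 where "max 2 ((2 * K * \<bar>T\<bar>) powr (1 / \<beta>)) < s0"
      and supp: "\<And>U. open U \<Longrightarrow> s0 \<in> U \<Longrightarrow> \<exists>x. E U x \<noteq> 0"
      using spectral_support_unbounded[OF unbounded] by blast
    then have s0: "2 < s0" and s0': "(2 * K * \<bar>T\<bar>) powr (1 / \<beta>) \<le> s0"
      by linarith+
    define t where "t = s0 powr \<beta> / (2 * K)"
    have "((2 * K * \<bar>T\<bar>) powr (1 / \<beta>)) powr \<beta> \<le> s0 powr \<beta>"
      using s0' beta_pos by (intro powr_mono2) auto
    then have "2 * K * \<bar>T\<bar> \<le> s0 powr \<beta>" using beta_pos K by (simp add: powr_powr)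
    then have "\<bar>T\<bar> \<le> t" using K by (simp add: t_def field_simps)
    moreover have "c \<le> ?g t"
    proof -
      have "t powr (1 / (2 * \<beta>)) = s0 powr (1 / 2) * (2 * K) powr - (1 / (2 * \<beta>))"
      proof -
        have "t powr (1 / (2 * \<beta>)) = (s0 powr \<beta>) powr (1 / (2 * \<beta>)) / (2 * K) powr (1 / (2 * \<beta>))"
          unfolding t_def by (rule powr_divide)
        also have "(s0 powr \<beta>) powr (1 / (2 * \<beta>)) = s0 powr (1 / 2)"
          unfolding powr_powr using beta_pos by simp
        finally show ?thesis by (simp only: powr_minus divide_inverse)
      qed
      moreover have "s0 powr (1 / 2) * s0 powr (- 1 / 2) = 1"
        using s0 powr_add[of s0 "1 / 2" "- 1 / 2"] by simp
      ultimately have "c = t powr (1 / (2 * \<beta>)) * (s0 powr (- 1 / 2) / (2 * (2 + K)))"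
        by (simp add: c_def)
      also have "\<dots> \<le> ?g t"
      proof (rule mult_left_mono)
        show "s0 powr (- 1 / 2) / (2 * (2 + K)) \<le> decay_rate X N G S t"
          unfolding t_def K_def
          by (rule decay_rate_at_spectral_point[OF semigroup generated stable f_nonneg beta_pos C(2,1)
                less_imp_le[OF s0] supp])
      qed simp
      finally show ?thesis .
    qed
    ultimately show ?thesis by (intro exI[of _ t]) auto
  qed
  \<comment> \<open>The lower bound holds only at arbitrarily large times, not at all of them; that
    suffices, since a smaller upper limit would put \<open>?g\<close> eventually below c.\<close>
  have "ereal c \<le> Limsup at_top (\<lambda>t. ereal (?g t))"
  proof (rule ccontr)
    assume "\<not> ?thesis"
    then have "\<forall>\<^sub>F t in at_top. ereal (?g t) < ereal c" by (intro Limsup_lessD) simp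
    then obtain T where "\<And>t. T \<le> t \<Longrightarrow> ?g t < c" by (auto simp: eventually_at_top_linorder)
    then have "\<not> c \<le> ?g t" if "T \<le> t" for t using that by (simp only: not_le)
    then show False using large[of T] by blast
  qed
  with c have "ereal 0 < Limsup at_top (\<lambda>t. ereal (?g t))"
    by (meson ereal_less_eq(3) less_ereal.simps(1) less_le_trans)
  then show ?thesis by (simp only: zero_ereal_def)
qed

end
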